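(* Let $d = \sum_{i=1}^{k} (d_i - 1) + \ell$ with $0 \le k < n$ and $0 < \ell \le d_{k+1} - 1$. Then every minimal weight codeword of $C_{\mathcal{X}}(d)$ (that is, every nonzero $f \in C_{\mathcal{X}}(d)$ with $|f| = \delta_{\mathcal{X}}(d)$) is $\mathcal{X}$-equivalent to a function of the form $$ g = \sigma \prod_{i=1,\, i \neq j}^{k+1} \left(1 - x_i^{d_i-1}\right) \prod_{t=1}^{d_j - (d_{k+1}-\ell)} \left(x_j - \alpha_t\right) $$ for some $1 \le j \le k+1$ such that $d_{k+1} - \ell \le d_j$, where $0 \neq \sigma \in \mathbb{F}_q$ and $\alpha_1, \ldots, \alpha_{d_j - (d_{k+1}-\ell)}$ are distinct elements of $K_j$ (if $d_j = d_{k+1} - \ell$ the second product is taken to be $1$).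
   Context: $\mathbb{F}_q$ is a finite field with $q$ elements, $n \ge 1$, and $K_1 \subset K_2 \subset \cdots \subset K_n \subset \mathbb{F}_q$ are subfields (inclusions need not be proper). Put $d_i = |K_i|$ (so $2 \le d_1 \le \cdots \le d_n$) and $\mathcal{X} = K_1 \times \cdots \times K_n \subset \mathbb{F}_q^n$. $C_{\mathcal{X}}$ is the $\mathbb{F}_q$-algebra of all functions $\mathcal{X} \to \mathbb{F}_q$. Each $f \in C_{\mathcal{X}}$ is induced by a unique polynomial $P \in \mathbb{F}_q[X_1,\ldots,X_n]$ whose degree in $X_i$ is less than $d_i$ for all $i$ (the reduced polynomial of $f$); the degree of $f$ is $\deg P$. $C_{\mathcal{X}}(d)$ is the $\mathbb{F}_q$-vector space of functions of degree at most $d$, together with the zero function (the affine cartesian code of order $d$). $|f|$ is the number of points of $\mathcal{X}$ where $f$ is nonzero, and $\delta_{\mathcal{X}}(d) = \min\{|f| : f \in C_{\mathcal{X}}(d),\ f \ne 0\}$. $x_i$ denotes the $i$-th coordinate function restricted to $\mathcal{X}$. $\mathrm{Aff}(n,\mathbb{F}_q)$ is the group of maps $\alpha \mapsto A\alpha + \beta$ of $\mathbb{F}_q^n$ with $A \in GL(n,\mathbb{F}_q)$, $\beta \in \mathbb{F}_q^n$, and $\mathrm{Aff}(\mathcal{X})$ is the set of restrictions $\psi|_{\mathcal{X}} : \mathcal{X} \to \mathcal{X}$ of those $\psi \in \mathrm{Aff}(n,\mathbb{F}_q)$ with $\psi(\mathcal{X}) = \mathcal{X}$. Functions $f, g \in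 C_{\mathcal{X}}$ are $\mathcal{X}$-equivalent if $f = g \circ \varphi$ for some $\varphi \in \mathrm{Aff}(\mathcal{X})$. *)

theory Defs
  imports
    "Jordan_Normal_Form.VS_Connect"
    "HOL-Library.FuncSet"
    "HOL-Library.Poly_Mapping"
    "HOL-Algebra.Subrings"
begin

text \<open>
  The field \<open>\<F>\<^sub>q\<close> is a type \<open>'a\<close> of class \<open>{field, finite}\<close>. Coordinates are numbered from \<open>0\<close>, as
  in the type of vectors, so \<open>K i\<close> and \<open>\<alpha> $ i\<close> for \<open>i < n\<close> correspond to \<open>K\<^sub>i\<^sub>+\<^sub>1\<close> and to the
  \<open>(i+1)\<close>-st coordinate in one-based numbering.
\<close>

definition cartesian :: "nat \<Rightarrow> (nat \<Rightarrow> 'a set) \<Rightarrow> 'a vec set"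
  where "cartesian n K = {\<alpha> \<in> carrier_vec n. \<forall>i<n. \<alpha> $ i \<in> K i}"

text \<open>
  A function \<open>\<X> \<rightarrow> \<F>\<^sub>q\<close> is represented by an extensional HOL function, i.e. one that is
  \<open>undefined\<close> off \<open>\<X>\<close>; equality of such functions is equality on \<open>\<X>\<close>.
\<close>

abbreviation functions_on :: "'a vec set \<Rightarrow> ('a vec \<Rightarrow> 'a) set"
  where "functions_on X \<equiv> X \<rightarrow>\<^sub>E UNIV"

abbreviation zero_function :: "'a::zero vec set \<Rightarrow> 'a vec \<Rightarrow> 'a"
  where "zero_function X \<equiv> (\<lambda>\<alpha>\<in>X. 0)"


subsection \<open>Polynomials and the degree of a function\<close>

text \<open>
  A polynomial maps exponent vectors, which are finitely supported functions from variable indices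
  to exponents, to coefficients.
\<close>

type_synonym 'a mpoly = "(nat \<Rightarrow>\<^sub>0 nat) \<Rightarrow>\<^sub>0 'a"

definition eval_mpoly :: "'a::comm_ring_1 mpoly \<Rightarrow> 'a vec \<Rightarrow> 'a"
  where "eval_mpoly P \<alpha> =
    (\<Sum>m\<in>Poly_Mapping.keys P. Poly_Mapping.lookup P m *
      (\<Prod>i\<in>Poly_Mapping.keys m. \<alpha> $ i ^ Poly_Mapping.lookup m i))"

text \<open>The total degree; the zero polynomial gets degree \<open>0\<close>.\<close>

definition total_degree :: "'a::zero mpoly \<Rightarrow> nat"
  where "total_degree P =
    Max (insert 0 ((\<lambda>m. \<Sum>i\<in>Poly_Mapping.keys m. Poly_Mapping.lookup m i) `
      Poly_Mapping.keys P))"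

text \<open>
  Polynomials in the variables with indices below \<open>n\<close> whose degree in variable \<open>i\<close> is less than
  \<open>card (K i)\<close>.
\<close>

definition reduced :: "nat \<Rightarrow> (nat \<Rightarrow> 'a set) \<Rightarrow> 'a::zero mpoly \<Rightarrow> bool"
  where "reduced n K P \<longleftrightarrow> (\<forall>m\<in>Poly_Mapping.keys P.
    Poly_Mapping.keys m \<subseteq> {..<n} \<and> (\<forall>i<n. Poly_Mapping.lookup m i < card (K i)))"

definition reduced_polynomial ::
    "nat \<Rightarrow> (nat \<Rightarrow> 'a set) \<Rightarrow> ('a vec \<Rightarrow> 'a) \<Rightarrow> 'a::comm_ring_1 mpoly"
  where "reduced_polynomial n K f =
    (THE P. reduced n K P \<and> (\<forall>\<alpha>\<in>cartesian n K. eval_mpoly P \<alpha> = f \<alpha>))"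

definition function_degree ::
    "nat \<Rightarrow> (nat \<Rightarrow> 'a set) \<Rightarrow> ('a vec \<Rightarrow> 'a::comm_ring_1) \<Rightarrow> nat"
  where "function_degree n K f = total_degree (reduced_polynomial n K f)"


subsection \<open>Affine cartesian codes\<close>

definition cartesian_code ::
    "nat \<Rightarrow> (nat \<Rightarrow> 'a set) \<Rightarrow> nat \<Rightarrow> ('a vec \<Rightarrow> 'a::comm_ring_1) set"
  where "cartesian_code n K d = {f \<in> functions_on (cartesian n K).
    f = zero_function (cartesian n K) \<or> function_degree n K f \<le> d}"

definition weight :: "'a vec set \<Rightarrow> ('a vec \<Rightarrow> 'a::zero) \<Rightarrow> nat"
  where "weight X f = card {\<alpha> \<in> X. f \<alpha> \<noteq> 0}"

definition min_distance :: "nat \<Rightarrow> (nat \<Rightarrow> 'a::comm_ring_1 set) \<Rightarrow> nat \<Rightarrow> nat"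
  where "min_distance n K d =
    Min (weight (cartesian n K) ` (cartesian_code n K d - {zero_function (cartesian n K)}))"


subsection \<open>Affine equivalence\<close>

definition affine_group :: "nat \<Rightarrow> ('a::comm_ring_1 vec \<Rightarrow> 'a vec) set"
  where "affine_group n = {\<lambda>\<alpha>\<in>carrier_vec n. A *\<^sub>v \<alpha> + \<beta> | A \<beta>.
    A \<in> carrier_mat n n \<and> invertible_mat A \<and> \<beta> \<in> carrier_vec n}"

definition affine_maps_on :: "nat \<Rightarrow> 'a::comm_ring_1 vec set \<Rightarrow> ('a vec \<Rightarrow> 'a vec) set"
  where "affine_maps_on n X = {restrict \<psi> X | \<psi>. \<psi> \<in> affine_group n \<and> \<psi> ` X = X}"

definition equivalent_on ::
    "nat \<Rightarrow> 'a::comm_ring_1 vec set \<Rightarrow> ('a vec \<Rightarrow> 'a) \<Rightarrow> ('a vec \<Rightarrow> 'a) \<Rightarrow> bool"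
  where "equivalent_on n X f g \<longleftrightarrow> (\<exists>\<phi>\<in>affine_maps_on n X. f = compose X g \<phi>)"

end

theory Submission
  imports Defs
begin

text \<open>
  Let \<open>D i = card (K i)\<close>. Slicing along one coordinate shows that the minimum distance is the minimum of
  \<open>\<Prod>b i\<close> over all \<open>b\<close> with \<open>1 \<le> b i \<le> D i\<close> and \<open>\<Sum>(D i - b i) \<le> d\<close>, and that for a
  codeword of minimal weight every nonzero slice along every admissible affine form again has
  minimal weight, so that its support \<open>S\<close> is equidistributed over the values that the form takes
  on \<open>S\<close>. If every form took all its values equally often on \<open>S\<close>, then \<open>S\<close> would be everything (a
  double count of forms through a point), so after an affine change of coordinates some \<open>x i\<close>
  takes only \<open>e < D i\<close> values on \<open>S\<close>. If \<open>e = 1\<close>, induct on the slice. If \<open>e > 1\<close>, optimality of \<open>b\<close>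
  forces the slices to be flats; unless they are full, one slice lies in a hyperplane, and some
  form in the pencil spanned by that hyperplane and \<open>x i\<close> is constant on the slice and one further
  point of \<open>S\<close>. This form takes fewer than \<open>e\<close> values on \<open>S\<close>, hence just one, because the multiset
  of entries of an optimal \<open>b\<close> is unique and has no entry strictly between \<open>1\<close> and \<open>e\<close>.
\<close>

section \<open>Optimal exponent vectors\<close>

text \<open>The obstacle is that the fields differ. A linear form is usable only if it is a
  coordinate of some affine bijection of the grid. By the chain condition the forms
  \<open>x i\<close> plus a combination of the \<open>x j\<close> with \<open>j < i\<close> and
  coefficients in \<open>K i\<close> have this property. Hence the double count runs over these
  forms and strips off the largest index, and the pencil argument asks which of two fields contains
  the other. Optimal vectors are not unique: the numbers of values taken by two forms are entries of
  different optimal vectors, at different positions. Only uniqueness of the multiset makes them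
  comparable. Slicing deletes an arbitrary coordinate and changes the degree, so the structure
  theorem is proved for every finite \<open>I\<close> and every \<open>d\<close>. The shape of
  \<open>d\<close> given by \<open>k\<close> and \<open>l\<close> matters only for the normal form,
  where swaps of coordinates over equal fields bring all root sets into the positions up to
  \<open>k\<close>. Degree is handled as a bound on functions of type \<open>nat => 'a\<close>,
  which slices and moves respect by mere substitution; reduced polynomials and matrices enter only
  at the end, as a translation.\<close>

text \<open>
  \<open>b\<close> records the product \<open>\<Prod>i \<Prod>c\<in>C i. (x i - c)\<close> with \<open>D i - b i\<close> roots in coordinate \<open>i\<close>: it has degree
  \<open>\<Sum>(D i - b i)\<close> and weight \<open>\<Prod>b i\<close>.
\<close>

definition feasible :: "nat set \<Rightarrow> (nat \<Rightarrow> nat) \<Rightarrow> nat \<Rightarrow> (nat \<Rightarrow> nat) \<Rightarrow> bool"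
  where "feasible I D d b \<longleftrightarrow>
    (\<forall>i\<in>I. 1 \<le> b i \<and> b i \<le> D i) \<and> (\<Sum>i\<in>I. D i - b i) \<le> d"

definition min_prod :: "nat set \<Rightarrow> (nat \<Rightarrow> nat) \<Rightarrow> nat \<Rightarrow> nat"
  where "min_prod I D d = (LEAST v. \<exists>b. feasible I D d b \<and> v = prod b I)"

definition optimal :: "nat set \<Rightarrow> (nat \<Rightarrow> nat) \<Rightarrow> nat \<Rightarrow> (nat \<Rightarrow> nat) \<Rightarrow> bool"
  where "optimal I D d b \<longleftrightarrow> feasible I D d b \<and> prod b I = min_prod I D d"

lemma min_prod_le: "feasible I D d b \<Longrightarrow> min_prod I D d \<le> prod b I"
  unfolding min_prod_def by (rule Least_le) blast

lemma ex_optimal: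
  assumes "\<And>i. i \<in> I \<Longrightarrow> 1 \<le> D i"
  obtains b where "optimal I D d b"
proof -
  have "feasible I D d D" using assms by (auto simp: feasible_def)
  then have "\<exists>v b. feasible I D d b \<and> v = prod b I" by blast
  from LeastI_ex[OF this] show ?thesis
    using that unfolding optimal_def min_prod_def by metis
qed

lemma optimal_le: "optimal I D d b \<Longrightarrow> feasible I D d b' \<Longrightarrow> prod b I \<le> prod b' I"
  using min_prod_le unfolding optimal_def by metis

lemma optimalI:
  "feasible I D d b \<Longrightarrow> prod b I \<le> min_prod I D d \<Longrightarrow> optimal I D d b"
  using min_prod_le[of I D d b] unfolding optimal_def by simp

lemma feasible_prod_pos: "feasible I D d b \<Longrightarrow> 0 < prod b I"
  unfolding feasible_def by (intro prod_pos) force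

lemma min_prod_pos:
  assumes "\<And>i. i \<in> I \<Longrightarrow> 1 \<le> D i"
  shows "0 < min_prod I D d"
  using ex_optimal[of I D d, OF assms] feasible_prod_pos unfolding optimal_def by metis

lemma prod_two:
  fixes b :: "nat \<Rightarrow> 'c::comm_monoid_mult"
  assumes "finite I" "i \<in> I" "j \<in> I" "i \<noteq> j"
  shows "prod b I = b i * b j * prod b (I - {i} - {j})"
  using assms by (simp add: prod.remove[of I i] prod.remove[of "I - {i}" j] mult.assoc)

lemma sum_two:
  fixes b :: "nat \<Rightarrow> 'c::comm_monoid_add"
  assumes "finite I" "i \<in> I" "j \<in> I" "i \<noteq> j"
  shows "sum b I = b i + b j + sum b (I - {i} - {j})"
  using assms by (simp add: sum.remove[of I i] sum.remove[of "I - {i}" j] add.assoc)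

text \<open>Shifting one unit from \<open>b i\<close> to \<open>b j\<close> keeps the sum, and (b_i
  - 1)(b_j + 1) < b_i b_j once \<open>b i \<le> b j\<close>. In particular an optimal vector has at
  most one entry strictly between 1 and its bound.\<close>

lemma optimal_exchange:
  assumes fin: "finite I" and opt: "optimal I D d b" and I: "i \<in> I" "j \<in> I" "i \<noteq> j"
    and "1 < b i" "b i \<le> b j"
  shows "b j = D j"
proof (rule ccontr)
  assume ne: "b j \<noteq> D j"
  have bD: "\<And>x. x \<in> I \<Longrightarrow> 1 \<le> b x \<and> b x \<le> D x" and s: "(\<Sum>i\<in>I. D i - b i) \<le> d"
    using opt by (auto simp: optimal_def feasible_def)
  define b' where "b' = b(i := b i - 1, j := b j + 1)"
  have lt: "b j < D j" using ne bD I by (meson le_neq_implies_less)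
  have "(\<Sum>x\<in>I. D x - b' x) = (\<Sum>x\<in>I. D x - b x)"
    unfolding sum_two[OF fin I] using I lt assms(6) bD[of i]
    by (auto simp: b'_def intro!: sum.cong)
  then have "feasible I D d b'"
    unfolding feasible_def using bD s lt assms(6) I
    by (auto simp: b'_def intro: le_trans[OF diff_le_self])
  from optimal_le[OF opt this] have "prod b I \<le> prod b' I" .
  moreover have "prod b' (I - {i} - {j}) = prod b (I - {i} - {j})"
    by (rule prod.cong) (auto simp: b'_def)
  moreover have "0 < prod b (I - {i} - {j})" using bD by (intro prod_pos) force
  ultimately have "b i * b j \<le> (b i - 1) * (b j + 1)"
    unfolding prod_two[OF fin I] using I by (simp add: b'_def)
  moreover obtain c where "b i = Suc (Suc c)" using assms(6) less_imp_Suc_add[of 1 "b i"] by auto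
  ultimately show False using assms(7) by (simp add: algebra_simps)
qed

text \<open>With budget left over, an entry above 1 could still be lowered.\<close>

lemma optimal_tight:
  assumes fin: "finite I" and opt: "optimal I D d b" and i: "i \<in> I" "1 < b i"
  shows "(\<Sum>i\<in>I. D i - b i) = d"
proof (rule ccontr)
  assume ne: "(\<Sum>i\<in>I. D i - b i) \<noteq> d"
  have bD: "\<And>x. x \<in> I \<Longrightarrow> 1 \<le> b x \<and> b x \<le> D x" and s: "(\<Sum>i\<in>I. D i - b i) < d"
    using opt ne by (auto simp: optimal_def feasible_def)
  define b' where "b' = b(i := b i - 1)"
  have "(\<Sum>x\<in>I. D x - b' x) = Suc (\<Sum>x\<in>I. D x - b x)"
    using i bD[of i] fin by (auto simp: b'_def sum.remove[of I i])
  then have "feasible I D d b'"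
    unfolding feasible_def using bD s i by (auto simp: b'_def intro: le_trans[OF diff_le_self])
  from optimal_le[OF opt this] have "prod b I \<le> prod b' I" .
  moreover have "prod b' (I - {i}) = prod b (I - {i})"
    by (rule prod.cong) (auto simp: b'_def)
  moreover have "0 < prod b (I - {i})" using bD by (intro prod_pos) force
  ultimately show False using i fin by (simp add: prod.remove[of I i] b'_def)
qed

lemma optimal_swap:
  assumes fin: "finite I" and opt: "optimal I D d b" and I: "i \<in> I" "j \<in> I"
    and le: "b j \<le> D i" "b i \<le> D j"
  shows "optimal I D d (b(i := b j, j := b i))"
proof (cases "i = j")
  case False
  define b' where "b' = b(i := b j, j := b i)"
  have bD: "\<And>x. x \<in> I \<Longrightarrow> 1 \<le> b x \<and> b x \<le> D x" and s: "(\<Sum>i\<in>I. D i - b i) \<le> d"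
    using opt by (auto simp: optimal_def feasible_def)
  have "(\<Sum>x\<in>I. D x - b' x) = (\<Sum>x\<in>I. D x - b x)"
    unfolding sum_two[OF fin I False] using I False le bD[of i] bD[of j]
    by (auto simp: b'_def intro!: sum.cong)
  then have "feasible I D d b'"
    unfolding feasible_def using bD s le I False by (auto simp: b'_def)
  moreover have "prod b' I = prod b I"
    unfolding prod_two[OF fin I False] using False by (auto simp: b'_def intro!: prod.cong)
  ultimately show ?thesis using opt unfolding optimal_def b'_def by simp
qed (use opt in simp)

lemma image_mset_swap:
  assumes "finite I" "i \<in> I" "j \<in> I"
  shows "image_mset (b(i := b j, j := b i)) (mset_set I) = image_mset b (mset_set I)"
proof -
  have "image_mset (transpose i j) (mset_set I) = mset_set (transpose i j ` I)"
    by (rule image_mset_mset_set) simp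
  also have "transpose i j ` I = I" using assms by (simp add: transpose_image_eq)
  finally have *: "image_mset (transpose i j) (mset_set I) = mset_set I" .
  have "b(i := b j, j := b i) = b \<circ> transpose i j" by (auto simp: transpose_def fun_eq_iff)
  then show ?thesis using * by (metis image_mset.compositionality)
qed

lemma feasible_insert_full:
  assumes fin: "finite I" and t: "t \<in> I" and "D t \<ge> 1" and f: "feasible (I - {t}) D d b"
  shows "feasible I D d (b(t := D t))"
proof -
  have "(\<Sum>x\<in>I - {t}. D x - (b(t := D t)) x) = (\<Sum>x\<in>I - {t}. D x - b x)"
    by (rule sum.cong) auto
  with assms show ?thesis by (auto simp: feasible_def sum.remove[of I t])
qed

text \<open>If \<open>b t\<close> were not full, the exchange argument would force all other entries
  to 1; these alone spend at least \<open>d\<close>, and \<open>t\<close> would spend more. So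
  \<open>t\<close> spends nothing and can be deleted.\<close>

lemma optimal_top_small:
  assumes fin: "finite I" and opt: "optimal I D d b" and t: "t \<in> I"
    and mx: "\<And>i. i \<in> I \<Longrightarrow> b i \<le> b t" and small: "d \<le> (\<Sum>i\<in>I - {t}. D i - 1)"
  shows "b t = D t \<and> optimal (I - {t}) D d b"
proof -
  have bD: "\<And>x. x \<in> I \<Longrightarrow> 1 \<le> b x \<and> b x \<le> D x" and s: "(\<Sum>i\<in>I. D i - b i) \<le> d"
    using opt by (auto simp: optimal_def feasible_def)
  have bt: "b t = D t"
  proof (rule ccontr)
    assume ne: "b t \<noteq> D t"
    have "b i = 1" if "i \<in> I - {t}" for i
      using optimal_exchange[OF fin opt, of i t] that ne mx[of i] bD[of i] t by force
    then have "(\<Sum>i\<in>I - {t}. D i - b i) = (\<Sum>i\<in>I - {t}. D i - 1)" by simp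
    moreover have "D t - b t > 0" using ne bD[OF t] by simp
    ultimately show False using s small fin t by (simp add: sum.remove[of I t])
  qed
  have f: "feasible (I - {t}) D d b"
    using s bD fin t bt by (auto simp: feasible_def sum.remove[of I t])
  have D1: "\<And>i. i \<in> I \<Longrightarrow> 1 \<le> D i" using bD by force
  obtain b' where b': "optimal (I - {t}) D d b'" using ex_optimal D1 by (metis DiffD1)
  have "feasible I D d (b'(t := D t))"
    using b' fin t D1 feasible_insert_full unfolding optimal_def by blast
  from optimal_le[OF opt this]
  have "D t * prod b (I - {t}) \<le> D t * prod (b'(t := D t)) (I - {t})"
    using fin t bt by (simp add: prod.remove[of I t])
  also have "prod (b'(t := D t)) (I - {t}) = prod b' (I - {t})" by (rule prod.cong) auto
  finally have "prod b (I - {t}) \<le> prod b' (I - {t})" using D1[OF t] by simp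
  then show ?thesis using f b' bt optimalI unfolding optimal_def by metis
qed

text \<open>The complementary case: an entry above 1 away from \<open>t\<close> would make
  \<open>b t\<close> full and leave all of \<open>d\<close> to the other coordinates, which cannot
  spend that much.\<close>

lemma optimal_top_large:
  assumes fin: "finite I" and opt: "optimal I D d b" and t: "t \<in> I"
    and mx: "\<And>i. i \<in> I \<Longrightarrow> b i \<le> b t" and large: "(\<Sum>i\<in>I - {t}. D i - 1) < d"
    and i: "i \<in> I - {t}"
  shows "b i = 1"
proof (rule ccontr)
  assume ne: "b i \<noteq> 1"
  have bD: "\<And>x. x \<in> I \<Longrightarrow> 1 \<le> b x \<and> b x \<le> D x"
    using opt by (auto simp: optimal_def feasible_def)
  have gt: "1 < b i" using ne bD[of i] i by auto
  then have "b t = D t" using optimal_exchange[OF fin opt, of i t] i t mx[of i] by auto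
  then have "(\<Sum>i\<in>I - {t}. D i - b i) = d"
    using optimal_tight[OF fin opt _ gt] i t fin by (simp add: sum.remove[of I t])
  moreover have "(\<Sum>i\<in>I - {t}. D i - b i) \<le> (\<Sum>i\<in>I - {t}. D i - 1)"
    using bD by (intro sum_mono diff_le_mono2) auto
  ultimately show False using large by simp
qed

lemma optimal_move_max:
  assumes fin: "finite I" and opt: "optimal I D d b" and t: "t \<in> I"
    and top: "\<And>i. i \<in> I \<Longrightarrow> D i \<le> D t"
  obtains b' where "optimal I D d b'" "\<And>i. i \<in> I \<Longrightarrow> b' i \<le> b' t"
    "image_mset b' (mset_set I) = image_mset b (mset_set I)"
proof -
  have bD: "\<And>x. x \<in> I \<Longrightarrow> 1 \<le> b x \<and> b x \<le> D x"
    using opt by (auto simp: optimal_def feasible_def)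
  have "finite (b ` I)" "b ` I \<noteq> {}" using fin t by auto
  then obtain s where s: "s \<in> I" "b s = Max (b ` I)" using Max_in[of "b ` I"] by (metis imageE)
  then have smax: "\<And>i. i \<in> I \<Longrightarrow> b i \<le> b s" using fin by simp
  show ?thesis
  proof (rule that[of "b(t := b s, s := b t)"])
    show "optimal I D d (b(t := b s, s := b t))"
      using optimal_swap[OF fin opt t s(1)] bD[OF s(1)] bD[OF t] smax[OF t] top[OF s(1)] by linarith
    show "(b(t := b s, s := b t)) i \<le> (b(t := b s, s := b t)) t" if "i \<in> I" for i
      using that smax t by auto
  qed (rule image_mset_swap[OF fin t s(1)])
qed

text \<open>Both vectors are first rearranged to carry their largest entry at a coordinate
  \<open>t\<close> with the largest bound. Which of the two cases then holds, full entry at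
  \<open>t\<close> or 1 everywhere else, is decided by \<open>d\<close> and the bounds alone, so it
  is the same for both.\<close>

lemma optimal_mset_unique:
  assumes "finite I" "optimal I D d b" "optimal I D d b'"
  shows "image_mset b (mset_set I) = image_mset b' (mset_set I)"
  using assms
proof (induction "card I" arbitrary: I b b')
  case (Suc n)
  note fin = \<open>finite I\<close>
  have ne: "finite (D ` I)" "D ` I \<noteq> {}" using Suc.hyps(2) fin by auto
  then obtain t where t: "t \<in> I" "D t = Max (D ` I)" using Max_in[of "D ` I"] by (metis imageE)
  then have top: "\<And>i. i \<in> I \<Longrightarrow> D i \<le> D t" using fin by simp
  obtain c where c: "optimal I D d c" "\<And>i. i \<in> I \<Longrightarrow> c i \<le> c t"
    "image_mset c (mset_set I) = image_mset b (mset_set I)"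
    using optimal_move_max[OF fin Suc.prems(2) t(1) top] by blast
  obtain c' where c': "optimal I D d c'" "\<And>i. i \<in> I \<Longrightarrow> c' i \<le> c' t"
    "image_mset c' (mset_set I) = image_mset b' (mset_set I)"
    using optimal_move_max[OF fin Suc.prems(3) t(1) top] by blast
  have I: "mset_set I = add_mset t (mset_set (I - {t}))" using fin t by (simp add: mset_set.remove)
  have "image_mset c (mset_set I) = image_mset c' (mset_set I)"
  proof (cases "d \<le> (\<Sum>i\<in>I - {t}. D i - 1)")
    case True
    have "image_mset c (mset_set (I - {t})) = image_mset c' (mset_set (I - {t}))"
      using Suc.hyps(1)[of "I - {t}" c c'] Suc.hyps(2) fin t(1)
        optimal_top_small[OF fin c(1) t(1) c(2) True] optimal_top_small[OF fin c'(1) t(1) c'(2) True]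
      by simp
    then show ?thesis
      using optimal_top_small[OF fin c(1) t(1) c(2) True] optimal_top_small[OF fin c'(1) t(1) c'(2) True]
      by (simp add: I)
  next
    case False
    have 1: "c i = 1" "c' i = 1" if "i \<in> I - {t}" for i
      using False that optimal_top_large[OF fin c(1) t(1) c(2)]
        optimal_top_large[OF fin c'(1) t(1) c'(2)] by auto
    then have "prod c I = c t" "prod c' I = c' t"
      using fin t(1) by (simp_all add: prod.remove[of I t])
    then have "c t = c' t" using c(1) c'(1) by (simp add: optimal_def)
    then show ?thesis using 1 fin by (auto simp: I intro!: image_mset_cong)
  qed
  then show ?case using c(3) c'(3) by simp
qed simp

text \<open>By uniqueness of the multiset \<open>b' j\<close> also occurs in \<open>b\<close>, and
  an entry of \<open>b\<close> strictly between 1 and \<open>b i\<close> would force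
  \<open>b i\<close> to be full.\<close>

lemma optimal_gap:
  assumes fin: "finite I" and opt: "optimal I D d b" "optimal I D d b'"
    and i: "i \<in> I" "1 < b i" "b i < D i" and j: "j \<in> I" "b' j < b i"
  shows "b' j = 1"
proof -
  have "b' j \<in># image_mset b' (mset_set I)" using fin j by simp
  then have "b' j \<in># image_mset b (mset_set I)" using optimal_mset_unique[OF fin opt] by simp
  then obtain x where x: "x \<in> I" "b x = b' j" using fin by auto
  have "1 \<le> b x" using x opt by (auto simp: optimal_def feasible_def)
  moreover have "\<not> 1 < b x"
    using optimal_exchange[OF fin opt(1) x(1) i(1)] i j x by fastforce
  ultimately show ?thesis using x by simp
qed

section \<open>Polynomial functions and their supports\<close>

text \<open>Functions instead of polynomials, with \<open>d\<close> only an upper bound for the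
  degree: composing with an affine map or fixing a coordinate is then plain substitution and never
  costs degree.\<close>

inductive polyfun :: "nat set \<Rightarrow> nat \<Rightarrow> ((nat \<Rightarrow> 'a::field) \<Rightarrow> 'a) \<Rightarrow> bool" for I where
  const: "polyfun I d (\<lambda>_. c)"
| add: "polyfun I d f \<Longrightarrow> polyfun I d g \<Longrightarrow> polyfun I d (\<lambda>x. f x + g x)"
| var: "polyfun I d f \<Longrightarrow> i \<in> I \<Longrightarrow> polyfun I (Suc d) (\<lambda>x. x i * f x)"

lemma polyfun_0: "polyfun I 0 f \<Longrightarrow> \<exists>c. f = (\<lambda>_. c)"
  by (induction "0::nat" f rule: polyfun.induct) auto

lemma polyfun_empty: "polyfun {} d f \<Longrightarrow> \<exists>c. f = (\<lambda>_. c)"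
  by (induction d f rule: polyfun.induct) auto

lemma polyfun_mono: "polyfun I d f \<Longrightarrow> d \<le> d' \<Longrightarrow> polyfun I d' f"
proof (induction arbitrary: d' rule: polyfun.induct)
  case (var d f i)
  then obtain e where "d' = Suc e" "d \<le> e" by (metis Suc_le_D Suc_le_mono)
  then show ?case using var by (simp add: polyfun.var)
qed (auto intro: polyfun.intros)

lemma polyfun_cmult: "polyfun I d f \<Longrightarrow> polyfun I d (\<lambda>x. c * f x)"
proof (induction rule: polyfun.induct)
  case (var d f i)
  then show ?case using polyfun.var[of I d "\<lambda>x. c * f x" i] by (simp add: mult.left_commute)
qed (auto simp: distrib_left intro: polyfun.intros)

lemma polyfun_mult: "polyfun I d f \<Longrightarrow> polyfun I e g \<Longrightarrow> polyfun I (d + e) (\<lambda>x. f x * g x)"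
proof (induction rule: polyfun.induct)
  case (const d c)
  then show ?case by (rule polyfun_mono[OF polyfun_cmult]) simp_all
next
  case (var d f i)
  then show ?case using polyfun.var[of I "d + e" "\<lambda>x. f x * g x" i] by (simp add: mult.assoc)
qed (auto simp: distrib_right intro: polyfun.intros)

lemma polyfun_var: "i \<in> I \<Longrightarrow> polyfun I 1 (\<lambda>x. x i)"
  using polyfun.var[OF polyfun.const[of I 0 1], of i] by simp

lemma polyfun_sum:
  "(\<And>j. j \<in> J \<Longrightarrow> polyfun I d (F j)) \<Longrightarrow> polyfun I d (\<lambda>x. \<Sum>j\<in>J. F j x)"
  by (induction J rule: infinite_finite_induct) (auto intro: polyfun.intros)

lemma polyfun_prod:
  "finite J \<Longrightarrow> (\<And>j. j \<in> J \<Longrightarrow> polyfun I (e j) (F j)) \<Longrightarrow>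
    polyfun I (\<Sum>j\<in>J. e j) (\<lambda>x. \<Prod>j\<in>J. F j x)"
  by (induction J rule: finite_induct) (auto intro: polyfun.intros polyfun_mult)

lemma polyfun_subst:
  "polyfun I d f \<Longrightarrow> (\<And>i. i \<in> I \<Longrightarrow> polyfun J 1 (\<lambda>x. \<phi> x i)) \<Longrightarrow> polyfun J d (\<lambda>x. f (\<phi> x))"
proof (induction rule: polyfun.induct)
  case (var d f i)
  then show ?case using polyfun_mult[of J 1 "\<lambda>x. \<phi> x i" d "\<lambda>x. f (\<phi> x)"] by simp
qed (auto intro: polyfun.intros)

lemma polyfun_slice: "polyfun I d f \<Longrightarrow> polyfun (I - {i}) d (\<lambda>x. f (x(i := c)))"
proof (rule polyfun_subst[where \<phi> = "\<lambda>x. x(i := c)"])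
  fix j assume "j \<in> I"
  then show "polyfun (I - {i}) 1 (\<lambda>x. (x(i := c)) j)"
    using polyfun_var[of j "I - {i}"] by (cases "j = i") (simp_all add: polyfun.const)
qed

text \<open>The factor theorem, with remainder \<open>f (x(i := c))\<close>. Constants form a
  separate alternative because the other one asserts \<open>0 < d\<close>, which later bounds the
  number of linear factors by the degree.\<close>

lemma polyfun_divide:
  "polyfun I d f \<Longrightarrow> i \<in> I \<Longrightarrow> (\<exists>c. f = (\<lambda>_. c)) \<or>
    (0 < d \<and> (\<exists>g. polyfun I (d - 1) g \<and> (\<forall>x. f x - f (x(i := c)) = (x i - c) * g x)))"
proof (induction rule: polyfun.induct)
  case (add d f g)
  show ?case
  proof (cases "d = 0")
    case True
    then show ?thesis using add polyfun_0[of I] by (metis polyfun.add)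
  next
    case False
    have ex: "\<exists>h. polyfun I (d - 1) h \<and> (\<forall>x. f x - f (x(i := c)) = (x i - c) * h x)"
      if "(\<exists>c. f = (\<lambda>_. c)) \<or>
        (0 < d \<and> (\<exists>g. polyfun I (d - 1) g \<and> (\<forall>x. f x - f (x(i := c)) = (x i - c) * g x)))" for f
      using that
    proof
      assume "\<exists>c. f = (\<lambda>_. c)"
      then show ?thesis by (intro exI[of _ "\<lambda>_. 0"]) (auto intro: polyfun.const)
    qed blast
    obtain h where h: "polyfun I (d - 1) h" "\<And>x. f x - f (x(i := c)) = (x i - c) * h x"
      using ex[OF add.IH(1)[OF add.prems]] by blast
    obtain h' where h': "polyfun I (d - 1) h'" "\<And>x. g x - g (x(i := c)) = (x i - c) * h' x"
      using ex[OF add.IH(2)[OF add.prems]] by blast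
    have "f x + g x - (f (x(i := c)) + g (x(i := c))) = (x i - c) * (h x + h' x)" for x
      unfolding distrib_left h(2)[symmetric] h'(2)[symmetric] by simp
    then show ?thesis using False polyfun.add[OF h(1) h'(1)] by blast
  qed
next
  case (var d f j)
  consider (const) a where "f = (\<lambda>_. a)" | (step) g where "0 < d" "polyfun I (d - 1) g"
    "\<And>x. f x - f (x(i := c)) = (x i - c) * g x"
    using var by blast
  then have "\<exists>g. polyfun I d g \<and>
    (\<forall>x. x j * f x - (x(i := c)) j * f (x(i := c)) = (x i - c) * g x)"
  proof cases
    case const
    then show ?thesis
      by (intro exI[of _ "\<lambda>_. if i = j then a else 0"]) (auto simp: algebra_simps intro: polyfun.const)
  next
    case step
    \<comment> \<open>For \<open>i = j\<close>, inserting f(c) = f(x) - (x - c) g(x) into x f(x) - c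
      f(c) gives (x - c)(f(x) + c g(x)).\<close>
    have p: "polyfun I d (\<lambda>x. if i = j then f x + c * g x else x j * g x)"
    proof (cases "i = j")
      case True
      then show ?thesis using step var
        by (auto intro!: polyfun.add polyfun_cmult intro: polyfun_mono[of I "d - 1"])
    next
      case False
      then show ?thesis using polyfun.var[OF step(2) var.hyps(2)] step(1) by simp
    qed
    have "x j * f x - (x(i := c)) j * f (x(i := c)) =
        (x i - c) * (if i = j then f x + c * g x else x j * g x)" for x
    proof -
      have fx: "f (x(i := c)) = f x - (x i - c) * g x" using step(3)[of x] by (simp add: algebra_simps)
      show ?thesis unfolding fx
        by (cases "i = j") (simp_all add: algebra_simps)
    qed
    then show ?thesis using p by blast
  qed
  then show ?case by (simp only: diff_Suc_1 zero_less_Suc simp_thms)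
qed auto

section \<open>Supports on the grid and their slices along a coordinate\<close>

definition supp :: "nat set \<Rightarrow> (nat \<Rightarrow> 'a set) \<Rightarrow> ((nat \<Rightarrow> 'a) \<Rightarrow> 'a::zero) \<Rightarrow> (nat \<Rightarrow> 'a) set"
  where "supp I K f = {x \<in> PiE I K. f x \<noteq> 0}"

lemma supp_box:
  fixes C :: "nat \<Rightarrow> 'a::{field, finite} set"
  assumes "finite I"
  shows "supp I K (\<lambda>x. \<Prod>i\<in>I. \<Prod>c\<in>C i. x i - c) = PiE I (\<lambda>i. K i - C i)"
proof (rule Set.set_eqI)
  fix x :: "nat \<Rightarrow> 'a"
  have "(\<Prod>i\<in>I. \<Prod>c\<in>C i. x i - c) \<noteq> 0 \<longleftrightarrow> (\<forall>i\<in>I. x i \<notin> C i)" using assms by auto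
  then show "x \<in> supp I K (\<lambda>x. \<Prod>i\<in>I. \<Prod>c\<in>C i. x i - c) \<longleftrightarrow> x \<in> PiE I (\<lambda>i. K i - C i)"
    by (auto simp: supp_def PiE_iff)
qed

text \<open>Each hyperplane that misses the support yields a linear factor and lowers the degree by
  one; the factors already split off do not vanish on the next hyperplane, so the quotient must. The
  support is assumed nonempty since the zero function satisfies no bound on
  \<open>card C\<close>.\<close>

lemma polyfun_divide_roots:
  fixes f :: "(nat \<Rightarrow> 'a::{field, finite}) \<Rightarrow> 'a"
  assumes "polyfun I d f" "i \<in> I" "C \<subseteq> K i" "\<And>x. x \<in> supp I K f \<Longrightarrow> x i \<notin> C"
    and "supp I K f \<noteq> {}"
  shows "card C \<le> d \<and> (\<exists>g. polyfun I (d - card C) g \<and>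
    (\<forall>x\<in>PiE I K. f x = (\<Prod>c\<in>C. x i - c) * g x))"
proof -
  have "finite C" by simp
  then show ?thesis using assms(3,4)
  proof (induction C rule: finite_induct)
    case empty
    then show ?case using assms(1) by auto
  next
    case (insert c C)
    then obtain g where le: "card C \<le> d" and g: "polyfun I (d - card C) g"
      and fg: "\<And>x. x \<in> PiE I K \<Longrightarrow> f x = (\<Prod>c\<in>C. x i - c) * g x" by auto
    have zero: "g (x(i := c)) = 0" if x: "x \<in> PiE I K" for x
    proof -
      have xc: "x(i := c) \<in> PiE I K" using x assms(2) insert.prems(1) by (auto simp: PiE_iff extensional_def)
      have "x(i := c) \<notin> supp I K f" using insert.prems(2)[of "x(i := c)"] by (metis fun_upd_same insertI1)
      then have "f (x(i := c)) = 0" using xc by (simp add: supp_def)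
      then show ?thesis using fg[OF xc] insert.hyps by auto
    qed
    \<comment> \<open>A constant quotient with a root would be zero and empty the support, so the
      alternative that lowers the degree applies.\<close>
    have "\<not> (\<exists>a. g = (\<lambda>_. a))"
    proof
      assume "\<exists>a. g = (\<lambda>_. a)"
      then have "\<forall>x\<in>PiE I K. g x = 0" using zero by fastforce
      then show False using fg assms(5) by (auto simp: supp_def)
    qed
    then obtain h where h: "0 < d - card C" "polyfun I (d - card C - 1) h"
      "\<And>x. g x - g (x(i := c)) = (x i - c) * h x"
      using polyfun_divide[OF g assms(2), of c] by blast
    have "g x = (x i - c) * h x" if "x \<in> PiE I K" for x
      using h(3)[of x] zero[OF that] by simp
    then have "\<And>x. x \<in> PiE I K \<Longrightarrow> f x = (\<Prod>c\<in>insert c C. x i - c) * h x"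
      using fg insert.hyps by (simp add: mult.left_commute)
    then show ?case using h insert.hyps by (auto simp: Suc_leI)
  qed
qed

lemma PiE_upd: "x \<in> PiE (I - {i}) K \<Longrightarrow> i \<in> I \<Longrightarrow> c \<in> K i \<Longrightarrow> x(i := c) \<in> PiE I K"
  by (auto simp: PiE_iff extensional_def)

lemma PiE_upd_undefined: "x \<in> PiE I K \<Longrightarrow> x(i := undefined) \<in> PiE (I - {i}) K"
  by (auto simp: PiE_iff extensional_def)

lemma supp_slice:
  assumes i: "i \<in> I" and v: "v \<in> K i"
    and h: "\<And>x. x \<in> PiE (I - {i}) K \<Longrightarrow> h x \<noteq> 0 \<longleftrightarrow> f (x(i := v)) \<noteq> 0"
  shows "bij_betw (\<lambda>x. x(i := v)) (supp (I - {i}) K h) {x \<in> supp I K f. x i = v}"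
proof (rule bij_betwI[where g = "\<lambda>x. x(i := undefined)"])
  show "(\<lambda>x. x(i := v)) \<in> supp (I - {i}) K h \<rightarrow> {x \<in> supp I K f. x i = v}"
    using i v h PiE_upd by (auto simp: supp_def)
  show "(\<lambda>x. x(i := undefined)) \<in> {x \<in> supp I K f. x i = v} \<rightarrow> supp (I - {i}) K h"
  proof
    fix x assume x: "x \<in> {x \<in> supp I K f. x i = v}"
    then have "x(i := undefined) \<in> PiE (I - {i}) K" by (intro PiE_upd_undefined) (simp add: supp_def)
    moreover have "x(i := undefined, i := v) = x" using x by auto
    ultimately show "x(i := undefined) \<in> supp (I - {i}) K h"
      using h[of "x(i := undefined)"] x by (simp add: supp_def)
  qed
  show "x(i := v, i := undefined) = x" if "x \<in> supp (I - {i}) K h" for x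
    using that by (auto simp: supp_def PiE_iff extensional_def)
  show "x(i := undefined, i := v) = x" if "x \<in> {x \<in> supp I K f. x i = v}" for x
    using that by auto
qed

text \<open>Restricting \<open>f\<close> itself to a slice gives degree at most \<open>d\<close>
  only. On the slice \<open>f\<close> is a constant times the quotient \<open>g\<close>, so
  \<open>h\<close> is defined from \<open>g\<close>: it has the lower degree and still the values of
  \<open>f\<close> on the grid.\<close>

lemma slice_structure:
  fixes f :: "(nat \<Rightarrow> 'a::{field, finite}) \<Rightarrow> 'a"
  assumes f: "polyfun I d f" and i: "i \<in> I" and ne: "supp I K f \<noteq> {}"
    and V: "V = (\<lambda>x. x i) ` supp I K f"
  obtains g h where "card (K i) - card V \<le> d"
    "polyfun I (d - (card (K i) - card V)) g"
    "\<And>x. x \<in> PiE I K \<Longrightarrow> f x = (\<Prod>c\<in>K i - V. x i - c) * g x"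
    "\<And>v. v \<in> V \<Longrightarrow> polyfun (I - {i}) (d - (card (K i) - card V)) (h v)"
    "\<And>v x. v \<in> V \<Longrightarrow> x \<in> PiE (I - {i}) K \<Longrightarrow> h v x = f (x(i := v))"
    "\<And>v. v \<in> V \<Longrightarrow> card {x \<in> supp I K f. x i = v} = card (supp (I - {i}) K (h v))"
    "\<And>v. v \<in> V \<Longrightarrow> supp (I - {i}) K (h v) \<noteq> {}"
proof -
  have VK: "V \<subseteq> K i" using i by (auto simp: V supp_def)
  then have cV: "card (K i - V) = card (K i) - card V" by (simp add: card_Diff_subset)
  obtain g where g: "card (K i) - card V \<le> d" "polyfun I (d - (card (K i) - card V)) g"
    "\<And>x. x \<in> PiE I K \<Longrightarrow> f x = (\<Prod>c\<in>K i - V. x i - c) * g x"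
    using polyfun_divide_roots[OF f i, of "K i - V" K] ne unfolding cV by (auto simp: V)
  define h where "h v x = (\<Prod>c\<in>K i - V. v - c) * g (x(i := v))" for v x
  have hf: "h v x = f (x(i := v))" if "v \<in> V" "x \<in> PiE (I - {i}) K" for v x
    using g(3)[OF PiE_upd[where K = K, OF that(2) i]] that VK by (auto simp: h_def)
  have hp: "polyfun (I - {i}) (d - (card (K i) - card V)) (h v)" for v
    unfolding h_def by (intro polyfun_cmult polyfun_slice g)
  have bij: "bij_betw (\<lambda>x. x(i := v)) (supp (I - {i}) K (h v)) {x \<in> supp I K f. x i = v}"
    if "v \<in> V" for v
    using that VK hf by (intro supp_slice i) auto
  show ?thesis
  proof (rule that[OF g hp hf])
    fix v assume v: "v \<in> V"
    show "card {x \<in> supp I K f. x i = v} = card (supp (I - {i}) K (h v))"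
      using bij_betw_same_card[OF bij[OF v]] by simp
    have "{x \<in> supp I K f. x i = v} \<noteq> {}" using v V by auto
    then show "supp (I - {i}) K (h v) \<noteq> {}" using bij[OF v] by (auto simp: bij_betw_def)
  qed
qed

section \<open>The minimum weight by recursion on coordinates\<close>

lemma feasible_insert:
  assumes fin: "finite I" and i: "i \<in> I" and b: "feasible (I - {i}) D (d - (D i - e)) b"
    and e: "1 \<le> e" "e \<le> D i" "D i - e \<le> d"
  shows "feasible I D d (b(i := e))" "prod (b(i := e)) I = e * prod b (I - {i})"
proof -
  have "(\<Sum>x\<in>I - {i}. D x - (b(i := e)) x) = (\<Sum>x\<in>I - {i}. D x - b x)"
    by (rule sum.cong) auto
  then show "feasible I D d (b(i := e))" using assms by (auto simp: feasible_def sum.remove[of I i])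
  have "prod (b(i := e)) (I - {i}) = prod b (I - {i})" by (rule prod.cong) auto
  then show "prod (b(i := e)) I = e * prod b (I - {i})" using fin i by (simp add: prod.remove[of I i])
qed

lemma min_prod_insert_le:
  assumes "finite I" "i \<in> I" "1 \<le> e" "e \<le> D i" "D i - e \<le> d" "\<And>i. i \<in> I \<Longrightarrow> 1 \<le> D i"
  shows "min_prod I D d \<le> e * min_prod (I - {i}) D (d - (D i - e))"
proof -
  obtain b where b: "optimal (I - {i}) D (d - (D i - e)) b"
    using ex_optimal assms(6) by (metis DiffD1)
  then have "feasible (I - {i}) D (d - (D i - e)) b" by (simp add: optimal_def)
  from feasible_insert[OF assms(1,2) this assms(3-5)] show ?thesis
    using min_prod_le b unfolding optimal_def by metis
qed

lemma card_supp_slices: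
  fixes f :: "(nat \<Rightarrow> 'a::{field, finite}) \<Rightarrow> 'a"
  assumes "finite I"
  shows "card (supp I K f) = (\<Sum>v\<in>(\<lambda>x. x i) ` supp I K f. card {x \<in> supp I K f. x i = v})"
proof -
  have fin: "finite (supp I K f)" using assms by (simp add: supp_def finite_PiE)
  have "card (supp I K f) = card (\<Union>v\<in>(\<lambda>x. x i) ` supp I K f. {x \<in> supp I K f. x i = v})"
    by (rule arg_cong[where f = card]) auto
  also have "\<dots> = (\<Sum>v\<in>(\<lambda>x. x i) ` supp I K f. card {x \<in> supp I K f. x i = v})"
    using fin by (intro card_UN_disjoint) auto
  finally show ?thesis .
qed

text \<open>Each of the \<open>card V\<close> slices is nonempty and obeys the bound for one
  coordinate less and the lowered degree; \<open>min_prod_insert_le\<close> with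
  \<open>e = card V\<close> is the matching recursion for \<open>min_prod\<close>.\<close>

lemma min_prod_le_card_supp:
  fixes f :: "(nat \<Rightarrow> 'a::{field, finite}) \<Rightarrow> 'a"
  assumes "finite I" "polyfun I d f" "supp I K f \<noteq> {}"
  shows "min_prod I (\<lambda>i. card (K i)) d \<le> card (supp I K f)"
  using assms
proof (induction "card I" arbitrary: I d f)
  case 0
  then have "feasible I (\<lambda>i. card (K i)) d (\<lambda>_. 1)" "prod (\<lambda>_. 1::nat) I = 1"
    by (auto simp: feasible_def)
  then have "min_prod I (\<lambda>i. card (K i)) d \<le> 1" using min_prod_le by metis
  also have "1 \<le> card (supp I K f)"
    using 0 by (simp add: supp_def finite_PiE Suc_le_eq card_gt_0_iff)
  finally show ?case .
next
  case (Suc n)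
  then obtain i where i: "i \<in> I" by (metis card_eq_0_iff ex_in_conv nat.simps(3))
  define V where "V = (\<lambda>x. x i) ` supp I K f"
  obtain g h where gh: "card (K i) - card V \<le> d"
    "\<And>v. v \<in> V \<Longrightarrow> polyfun (I - {i}) (d - (card (K i) - card V)) (h v)"
    "\<And>v. v \<in> V \<Longrightarrow> card {x \<in> supp I K f. x i = v} = card (supp (I - {i}) K (h v))"
    "\<And>v. v \<in> V \<Longrightarrow> supp (I - {i}) K (h v) \<noteq> {}"
    by (rule slice_structure[OF Suc.prems(2) i Suc.prems(3) V_def]) blast
  let ?\<mu> = "min_prod (I - {i}) (\<lambda>i. card (K i)) (d - (card (K i) - card V))"
  have VK: "V \<subseteq> K i" using i by (auto simp: V_def supp_def)
  have "PiE I K \<noteq> {}" using Suc.prems(3) by (auto simp: supp_def)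
  then have K1: "\<And>i. i \<in> I \<Longrightarrow> 1 \<le> card (K i)" by (auto simp: PiE_eq_empty_iff Suc_le_eq card_gt_0_iff)
  have "min_prod I (\<lambda>i. card (K i)) d \<le> card V * ?\<mu>"
    using min_prod_insert_le[of I i "card V" "\<lambda>i. card (K i)" d] Suc.prems i gh(1) K1 VK
    by (auto simp: card_mono Suc_le_eq card_gt_0_iff V_def)
  also have "\<dots> = (\<Sum>v\<in>V. ?\<mu>)" by simp
  also have "\<dots> \<le> (\<Sum>v\<in>V. card {x \<in> supp I K f. x i = v})"
  proof (rule sum_mono)
    fix v assume v: "v \<in> V"
    show "?\<mu> \<le> card {x \<in> supp I K f. x i = v}"
      unfolding gh(3)[OF v] using Suc.hyps(2) Suc.prems(1) i
      by (intro Suc.hyps(1) gh(2)[OF v] gh(4)[OF v]) auto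
  qed
  also have "\<dots> = card (supp I K f)" unfolding V_def by (rule card_supp_slices[OF Suc.prems(1), symmetric])
  finally show ?case .
qed

text \<open>Minimality of \<open>f\<close> turns the slicing bound into equalities: all slices have
  the same, minimal weight, and an optimal vector of the slice stays optimal when
  \<open>card V\<close> is put at \<open>i\<close>. The last conclusion is what makes the number of
  values of a coordinate an entry of an optimal vector.\<close>

lemma minimal_slices:
  fixes f :: "(nat \<Rightarrow> 'a::{field, finite}) \<Rightarrow> 'a"
  assumes fin: "finite I" and f: "polyfun I d f" and ne: "supp I K f \<noteq> {}"
    and mn: "card (supp I K f) = min_prod I (\<lambda>i. card (K i)) d" and i: "i \<in> I"
    and V: "V = (\<lambda>x. x i) ` supp I K f" and d': "d' = d - (card (K i) - card V)"
  obtains g h where "card (K i) - card V \<le> d"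
    "polyfun I d' g"
    "\<And>x. x \<in> PiE I K \<Longrightarrow> f x = (\<Prod>c\<in>K i - V. x i - c) * g x"
    "\<And>v. v \<in> V \<Longrightarrow> polyfun (I - {i}) d' (h v)"
    "\<And>v x. v \<in> V \<Longrightarrow> x \<in> PiE (I - {i}) K \<Longrightarrow> h v x = f (x(i := v))"
    "\<And>v. v \<in> V \<Longrightarrow> card {x \<in> supp I K f. x i = v} = card (supp (I - {i}) K (h v))"
    "\<And>v. v \<in> V \<Longrightarrow> supp (I - {i}) K (h v) \<noteq> {}"
    "\<And>v. v \<in> V \<Longrightarrow> card (supp (I - {i}) K (h v)) = min_prod (I - {i}) (\<lambda>i. card (K i)) d'"
    "\<And>v. v \<in> V \<Longrightarrow> card V * card {x \<in> supp I K f. x i = v} = card (supp I K f)"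
    "\<And>b. optimal (I - {i}) (\<lambda>i. card (K i)) d' b \<Longrightarrow> optimal I (\<lambda>i. card (K i)) d (b(i := card V))"
proof -
  obtain g h where gh: "card (K i) - card V \<le> d"
    "polyfun I d' g"
    "\<And>x. x \<in> PiE I K \<Longrightarrow> f x = (\<Prod>c\<in>K i - V. x i - c) * g x"
    "\<And>v. v \<in> V \<Longrightarrow> polyfun (I - {i}) d' (h v)"
    "\<And>v x. v \<in> V \<Longrightarrow> x \<in> PiE (I - {i}) K \<Longrightarrow> h v x = f (x(i := v))"
    "\<And>v. v \<in> V \<Longrightarrow> card {x \<in> supp I K f. x i = v} = card (supp (I - {i}) K (h v))"
    "\<And>v. v \<in> V \<Longrightarrow> supp (I - {i}) K (h v) \<noteq> {}"
    unfolding d' by (rule slice_structure[OF f i ne V]) blast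
  let ?\<mu> = "min_prod (I - {i}) (\<lambda>i. card (K i)) d'"
  have VK: "V \<subseteq> K i" using i by (auto simp: V supp_def)
  have "PiE I K \<noteq> {}" using ne by (auto simp: supp_def)
  then have K1: "\<And>i. i \<in> I \<Longrightarrow> 1 \<le> card (K i)" by (auto simp: PiE_eq_empty_iff Suc_le_eq card_gt_0_iff)
  have V1: "1 \<le> card V" "card V \<le> card (K i)"
    using ne VK by (auto simp: V card_mono Suc_le_eq card_gt_0_iff)
  have ge: "?\<mu> \<le> card (supp (I - {i}) K (h v))" if "v \<in> V" for v
    using min_prod_le_card_supp[of "I - {i}" d' "h v" K] fin gh(4)[OF that] gh(7)[OF that] by simp
  have le: "card (supp I K f) \<le> card V * ?\<mu>"
    using min_prod_insert_le[of I i "card V" "\<lambda>i. card (K i)" d] fin i gh(1) K1 V1 mn d' by simp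
  have tot: "card (supp I K f) = (\<Sum>v\<in>V. card (supp (I - {i}) K (h v)))"
    unfolding card_supp_slices[OF fin, of K f i] V[symmetric] using gh(6) by simp
  have eq: "card (supp (I - {i}) K (h v)) = ?\<mu>" if v: "v \<in> V" for v
  proof (rule ccontr)
    assume "card (supp (I - {i}) K (h v)) \<noteq> ?\<mu>"
    then have "?\<mu> < card (supp (I - {i}) K (h v))" using ge[OF v] by simp
    then have "(\<Sum>v\<in>V. ?\<mu>) < (\<Sum>v\<in>V. card (supp (I - {i}) K (h v)))"
      using v ge by (intro sum_strict_mono_ex1) auto
    then show False using le tot by simp
  qed
  then have tot': "card (supp I K f) = card V * ?\<mu>" using tot by simp
  show ?thesis
  proof (rule that[OF gh eq])
    show "card V * card {x \<in> supp I K f. x i = v} = card (supp I K f)" if "v \<in> V" for v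
      using that gh(6) eq tot' by simp
    show "optimal I (\<lambda>i. card (K i)) d (b(i := card V))"
      if "optimal (I - {i}) (\<lambda>i. card (K i)) d' b" for b
    proof -
      have "feasible (I - {i}) (\<lambda>i. card (K i)) (d - (card (K i) - card V)) b"
        using that d' by (simp add: optimal_def)
      from feasible_insert[OF fin i this V1 gh(1)] show ?thesis
        using tot' mn that by (simp add: optimal_def)
    qed
  qed
qed

section \<open>Affine moves along a tower of fields\<close>

text \<open>Affine bijections of the grid by generators instead of matrices, so that degree,
  invariance of the grid and invertibility are checked on elementary maps. A shear may add a
  multiple of \<open>x j\<close> to \<open>x i\<close> only if \<open>K j\<close> lies in
  \<open>K i\<close>, and a swap needs equal fields.\<close>

inductive moves :: "nat set \<Rightarrow> (nat \<Rightarrow> 'a::field set) \<Rightarrow> ((nat \<Rightarrow> 'a) \<Rightarrow> (nat \<Rightarrow> 'a)) \<Rightarrow> bool"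
  for I K where
  ident: "moves I K (\<lambda>x. x)"
| comp: "moves I K \<phi> \<Longrightarrow> moves I K \<psi> \<Longrightarrow> moves I K (\<lambda>x. \<phi> (\<psi> x))"
| translation: "i \<in> I \<Longrightarrow> c \<in> K i \<Longrightarrow> moves I K (\<lambda>x. x(i := x i + c))"
| shear: "i \<in> I \<Longrightarrow> j \<in> I \<Longrightarrow> i \<noteq> j \<Longrightarrow> a \<in> K i \<Longrightarrow> K j \<subseteq> K i \<Longrightarrow>
    moves I K (\<lambda>x. x(i := x i + a * x j))"
| swap: "i \<in> I \<Longrightarrow> j \<in> I \<Longrightarrow> K i = K j \<Longrightarrow> moves I K (\<lambda>x. x(i := x j, j := x i))"

lemma moves_mono: "moves I K \<phi> \<Longrightarrow> I \<subseteq> J \<Longrightarrow> moves J K \<phi>"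
  by (induction rule: moves.induct) (auto intro: moves.intros)

lemma moves_polyfun: "moves I K \<phi> \<Longrightarrow> i \<in> I \<Longrightarrow> polyfun I 1 (\<lambda>x. \<phi> x i)"
proof (induction arbitrary: i rule: moves.induct)
  case ident
  then show ?case by (rule polyfun_var)
next
  case (comp \<phi> \<psi>)
  then show ?case using polyfun_subst[of I 1 "\<lambda>x. \<phi> x i" I \<psi>] by simp
next
  case (translation j c)
  then show ?case using polyfun.add[OF polyfun_var[of i I] polyfun.const[of I 1 c]] polyfun_var[of i I]
    by (cases "i = j") simp_all
next
  case (shear k j a)
  then show ?case using polyfun.add[OF polyfun_var[of k I] polyfun_cmult[OF polyfun_var[of j I], of a]]
      polyfun_var[of i I]
    by (cases "i = k") simp_all
next
  case (swap k j)
  then show ?case using polyfun_var[of _ I] by (cases "i = j"; cases "i = k") simp_all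
qed

text \<open>A move on \<open>I\<close> neither reads nor writes other coordinates. A move found for
  one slice along \<open>i\<close> can therefore be applied to the whole grid.\<close>

lemma moves_outside: "moves I K \<phi> \<Longrightarrow> i \<notin> I \<Longrightarrow> \<phi> (x(i := c)) = (\<phi> x)(i := c)"
proof (induction arbitrary: x rule: moves.induct)
  case (comp \<phi> \<psi>)
  then show ?case by simp
qed (auto simp: fun_eq_iff)

lemma polyfun_moves: "polyfun I d f \<Longrightarrow> moves I K \<phi> \<Longrightarrow> polyfun I d (\<lambda>x. f (\<phi> x))"
  using polyfun_subst[of I d f I \<phi>] moves_polyfun[of I K \<phi>] by blast

locale field_tower =
  fixes K :: "nat \<Rightarrow> 'a::{field, finite} set" and N :: "nat set"
  assumes zero: "i \<in> N \<Longrightarrow> 0 \<in> K i"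
    and one: "i \<in> N \<Longrightarrow> 1 \<in> K i"
    and add: "i \<in> N \<Longrightarrow> a \<in> K i \<Longrightarrow> b \<in> K i \<Longrightarrow> a + b \<in> K i"
    and mult: "i \<in> N \<Longrightarrow> a \<in> K i \<Longrightarrow> b \<in> K i \<Longrightarrow> a * b \<in> K i"
    and uminus: "i \<in> N \<Longrightarrow> a \<in> K i \<Longrightarrow> - a \<in> K i"
    and inverse: "i \<in> N \<Longrightarrow> a \<in> K i \<Longrightarrow> inverse a \<in> K i"
    and chain: "i \<in> N \<Longrightarrow> j \<in> N \<Longrightarrow> i \<le> j \<Longrightarrow> K i \<subseteq> K j"
begin

lemma diff: "i \<in> N \<Longrightarrow> a \<in> K i \<Longrightarrow> b \<in> K i \<Longrightarrow> a - b \<in> K i"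
  using add[of i a "- b"] uminus[of i b] by simp

lemma divide: "i \<in> N \<Longrightarrow> a \<in> K i \<Longrightarrow> b \<in> K i \<Longrightarrow> a / b \<in> K i"
  using mult[of i a "inverse b"] inverse[of i b] by (simp add: divide_inverse)

lemma sum: "i \<in> N \<Longrightarrow> (\<And>j. j \<in> J \<Longrightarrow> g j \<in> K i) \<Longrightarrow> sum g J \<in> K i"
  by (induction J rule: infinite_finite_induct) (auto intro: add zero)

lemma card_ge_2: "i \<in> N \<Longrightarrow> 2 \<le> card (K i)"
  using card_mono[of "K i" "{0, 1}"] zero one by simp

lemma moves_PiE:
  assumes "moves I K \<phi>" "I \<subseteq> N" "x \<in> PiE I K"
  shows "\<phi> x \<in> PiE I K"
  using assms
proof (induction arbitrary: x rule: moves.induct)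
  case (translation i c)
  then show ?case by (auto simp: PiE_iff extensional_def intro: add)
next
  case (shear i j a)
  have "x i + a * x j \<in> K i" using shear by (intro add mult) (auto simp: PiE_iff)
  then show ?case using shear by (auto simp: PiE_iff extensional_def)
next
  case (swap i j)
  then show ?case by (auto simp: PiE_iff extensional_def)
qed auto

lemma moves_inverse:
  assumes "moves I K \<phi>" "I \<subseteq> N"
  shows "\<exists>\<psi>. moves I K \<psi> \<and> (\<forall>x. \<phi> (\<psi> x) = x) \<and> (\<forall>x. \<psi> (\<phi> x) = x)"
  using assms
proof (induction rule: moves.induct)
  case (comp \<phi> \<psi>)
  then obtain \<phi>' \<psi>' where "moves I K \<phi>'" "moves I K \<psi>'" "\<forall>x. \<phi> (\<phi>' x) = x" "\<forall>x. \<phi>' (\<phi> x) = x"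
    "\<forall>x. \<psi> (\<psi>' x) = x" "\<forall>x. \<psi>' (\<psi> x) = x" by blast
  then show ?case by (intro exI[of _ "\<lambda>x. \<psi>' (\<phi>' x)"]) (auto intro: moves.comp)
next
  case (translation i c)
  then have "moves I K (\<lambda>x. x(i := x i + - c))" using uminus by (intro moves.translation) auto
  then show ?case by (intro exI[of _ "\<lambda>x. x(i := x i + - c)"] conjI allI) (assumption, auto)
next
  case (shear i j a)
  then have "moves I K (\<lambda>x. x(i := x i + - a * x j))" using uminus by (intro moves.shear) auto
  then show ?case using shear.hyps
    by (intro exI[of _ "\<lambda>x. x(i := x i + - a * x j)"] conjI allI) (assumption, auto)
next
  case (swap i j)
  then have "moves I K (\<lambda>x. x(i := x j, j := x i))" by (intro moves.swap)
  then show ?case by (intro exI[of _ "\<lambda>x. x(i := x j, j := x i)"] conjI allI)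
      (assumption, auto simp: fun_eq_iff)
qed (auto intro: moves.ident)

lemma moves_supp:
  assumes "moves I K \<phi>" "I \<subseteq> N"
  shows "bij_betw \<phi> (supp I K (\<lambda>x. f (\<phi> x))) (supp I K f)"
proof -
  obtain \<psi> where \<psi>: "moves I K \<psi>" "\<forall>x. \<phi> (\<psi> x) = x" "\<forall>x. \<psi> (\<phi> x) = x"
    using moves_inverse[OF assms] by blast
  show ?thesis
    by (rule bij_betwI[where g = \<psi>])
      (use \<psi> moves_PiE[OF assms] moves_PiE[OF \<psi>(1) assms(2)] in \<open>auto simp: supp_def\<close>)
qed

text \<open>Turns a form \<open>x i\<close> plus a combination of other coordinates into a
  coordinate, so that results on slices along coordinates apply to forms.\<close>

lemma moves_multi_shear:
  assumes "finite J" "J \<subseteq> I" "I \<subseteq> N" "i \<in> I" "i \<notin> J" "\<And>j. j \<in> J \<Longrightarrow> K j \<subseteq> K i \<and> a j \<in> K i"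
  shows "moves I K (\<lambda>x. x(i := x i + (\<Sum>j\<in>J. a j * x j)))"
  using assms
proof (induction J rule: finite_induct)
  case empty
  then show ?case by (simp add: moves.ident)
next
  case (insert j J)
  define g h where "g x = x(i := x i + (\<Sum>j\<in>J. a j * x j))" and "h x = x(i := x i + a j * x j)" for x
  have "moves I K g" unfolding g_def by (rule insert.IH) (use insert.prems in auto)
  moreover have "moves I K h" unfolding h_def using insert by (intro moves.shear) auto
  ultimately have gh: "moves I K (\<lambda>x. g (h x))" by (rule moves.comp)
  have "g (h x) = x(i := x i + (\<Sum>j\<in>insert j J. a j * x j))" for x
  proof -
    have "(\<Sum>k\<in>J. a k * h x k) = (\<Sum>k\<in>J. a k * x k)"
      using insert.prems(4) by (intro sum.cong) (auto simp: h_def)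
    moreover have "h x i = x i + a j * x j" "(h x)(i := c) = x(i := c)" for c by (simp_all add: h_def)
    ultimately show ?thesis using insert.hyps by (simp add: g_def add.assoc)
  qed
  then show ?case using gh by (simp only:)
qed

section \<open>Sets on which all admissible forms are equidistributed\<close>

lemma card_linear_solutions:
  assumes fin: "finite J" and i: "i \<in> N" and v: "\<And>j. j \<in> J \<Longrightarrow> v j \<in> K i" and w: "w \<in> K i"
    and j: "j \<in> J" "v j \<noteq> 0"
  shows "card (K i) * card {a \<in> PiE J (\<lambda>_. K i). (\<Sum>j\<in>J. a j * v j) = w} = card (K i) ^ card J"
proof -
  \<comment> \<open>\<open>s b\<close> is the value of the coefficient at \<open>j\<close> that
    solves the equation; it depends on the other coefficients only.\<close>
  define s where "s b = (w - (\<Sum>k\<in>J - {j}. b k * v k)) / v j" for b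
  let ?A = "{a \<in> PiE J (\<lambda>_. K i). (\<Sum>j\<in>J. a j * v j) = w}"
  have eq: "(\<Sum>k\<in>J. a k * v k) = w \<longleftrightarrow> a j = s a" for a
    using fin j by (auto simp: s_def sum.remove[of J j] field_simps)
  have s_upd: "s (a(j := c)) = s a" for a c
    unfolding s_def by (metis (no_types, lifting) Diff_iff fun_upd_other insertI1 sum.cong)
  have sK: "s b \<in> K i" if "b \<in> PiE (J - {j}) (\<lambda>_. K i)" for b
    unfolding s_def using that i v w j by (intro divide diff sum mult) (auto simp: PiE_iff)
  have A: "?A = {a \<in> PiE J (\<lambda>_. K i). a j = s a}" unfolding eq ..
  have "bij_betw (\<lambda>b. b(j := s b)) (PiE (J - {j}) (\<lambda>_. K i)) ?A"
    unfolding A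
  proof (rule bij_betwI[where g = "\<lambda>a. a(j := undefined)"])
    show "(\<lambda>b. b(j := s b)) \<in> PiE (J - {j}) (\<lambda>_. K i) \<rightarrow> {a \<in> PiE J (\<lambda>_. K i). a j = s a}"
    proof
      fix b assume b: "b \<in> PiE (J - {j}) (\<lambda>_. K i)"
      from PiE_upd[OF this j(1) sK[OF b]]
      show "b(j := s b) \<in> {a \<in> PiE J (\<lambda>_. K i). a j = s a}" by (simp add: s_upd)
    qed
    show "(\<lambda>a. a(j := undefined)) \<in> {a \<in> PiE J (\<lambda>_. K i). a j = s a} \<rightarrow> PiE (J - {j}) (\<lambda>_. K i)"
      using PiE_upd_undefined[of _ J "\<lambda>_. K i" j] by blast
    show "b(j := s b, j := undefined) = b" if "b \<in> PiE (J - {j}) (\<lambda>_. K i)" for b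
      using PiE_arb[OF that, of j] by (simp add: fun_upd_idem)
    show "a(j := undefined, j := s (a(j := undefined))) = a"
      if "a \<in> {a \<in> PiE J (\<lambda>_. K i). a j = s a}" for a
      using that by (simp add: s_upd fun_upd_idem)
  qed
  then have "card ?A = card (PiE (J - {j}) (\<lambda>_. K i))" by (simp add: bij_betw_same_card)
  also have "\<dots> = card (K i) ^ (card J - 1)" using fin j by (simp add: card_PiE)
  finally have "card ?A = card (K i) ^ (card J - 1)" .
  moreover have "0 < card J" using fin j by (auto simp: card_gt_0_iff)
  ultimately show ?thesis
    using power_minus_mult[of "card J" "card (K i)"] by (simp add: mult.commute)
qed

text \<open>
  Count the pairs of a form \<open>x i + \<Sum>a j * x j\<close> and a point of \<open>S\<close> on which it agrees with its value
  at \<open>x\<close>: points that differ from \<open>x\<close> in some \<open>j \<in> J\<close> all contribute equally, so the line through \<open>x\<close>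
  in direction \<open>i\<close> must contain exactly \<open>card (K i)\<close> points of \<open>S\<close>.
\<close>

lemma line_in_equidistributed:
  assumes fin: "finite J" and N: "insert i J \<subseteq> N" and i: "i \<notin> J" and le: "\<And>j. j \<in> J \<Longrightarrow> j \<le> i"
    and S: "S \<subseteq> PiE (insert i J) K"
    and eq: "\<And>a c. a \<in> PiE J (\<lambda>_. K i) \<Longrightarrow> c \<in> K i \<Longrightarrow>
      card (K i) * card {x \<in> S. x i + (\<Sum>j\<in>J. a j * x j) = c} = card S"
    and x: "x \<in> S" and c: "c \<in> K i"
  shows "x(i := c) \<in> S"
proof -
  have finS: "finite S" using finite_subset[OF S] fin by (simp add: finite_PiE)
  define A where "A = PiE J (\<lambda>_. K i)"
  have finA: "finite A" using fin by (simp add: A_def finite_PiE)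
  have cA: "card A = card (K i) ^ card J" using fin by (simp add: A_def card_PiE)
  have in_K: "y j \<in> K i" if "y \<in> S" "j \<in> insert i J" for y j
    using that S N le chain[of j i] by (auto simp: PiE_iff)
  define P where "P a y \<longleftrightarrow> y i + (\<Sum>j\<in>J. a j * y j) = x i + (\<Sum>j\<in>J. a j * x j)" for a y
  have P: "P a y \<longleftrightarrow> (\<Sum>j\<in>J. a j * (y j - x j)) = x i - y i" for a y
    by (auto simp: P_def algebra_simps sum_subtractf)
  have "card A * card S = (\<Sum>a\<in>A. card (K i) * card {y \<in> S. P a y})"
  proof -
    have "card (K i) * card {y \<in> S. P a y} = card S" if "a \<in> A" for a
      unfolding P_def
    proof (rule eq)
      show "x i + (\<Sum>j\<in>J. a j * x j) \<in> K i"
        using N in_K[OF x] that by (intro add sum mult) (auto simp: A_def PiE_iff)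
    qed (use that in \<open>simp add: A_def\<close>)
    then show ?thesis by simp
  qed
  also have "\<dots> = (\<Sum>y\<in>S. card (K i) * card {a \<in> A. P a y})"
  proof -
    have "(\<Sum>a\<in>A. card {y \<in> S. P a y}) = (\<Sum>a\<in>A. \<Sum>y\<in>S. if P a y then 1 else 0)"
      using finS by (simp add: sum.If_cases Int_def)
    also have "\<dots> = (\<Sum>y\<in>S. \<Sum>a\<in>A. if P a y then 1 else 0)" by (rule sum.swap)
    also have "\<dots> = (\<Sum>y\<in>S. card {a \<in> A. P a y})" using finA by (simp add: sum.If_cases Int_def)
    finally show ?thesis by (simp add: sum_distrib_left[symmetric])
  qed
  \<comment> \<open>On a point of the line other than \<open>x\<close> itself, every form differs
    from its value at \<open>x\<close> by \<open>y i - x i\<close>, which is nonzero; hence the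
    contribution 0.\<close>
  also have "\<dots> = (\<Sum>y\<in>S. if \<forall>j\<in>J. y j = x j then (if y = x then card (K i) * card A else 0) else card A)"
  proof (rule sum.cong)
    fix y assume y: "y \<in> S"
    show "card (K i) * card {a \<in> A. P a y} =
      (if \<forall>j\<in>J. y j = x j then (if y = x then card (K i) * card A else 0) else card A)"
    proof (cases "\<forall>j\<in>J. y j = x j")
      case True
      have "y = x \<longleftrightarrow> y i = x i"
        using True x y S by (auto intro!: PiE_ext[of y "insert i J" K x])
      then have "P a y \<longleftrightarrow> y = x" for a using True by (auto simp: P)
      then show ?thesis using True by (cases "y = x") auto
    next
      case False
      then obtain j where j: "j \<in> J" "y j - x j \<noteq> 0" by auto
      have "card (K i) * card {a \<in> PiE J (\<lambda>_. K i). (\<Sum>j\<in>J. a j * (y j - x j)) = x i - y i} =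
          card (K i) ^ card J"
        using N in_K[OF x] in_K[OF y] j by (intro card_linear_solutions[OF fin, where j = j] diff) auto
      then show ?thesis unfolding if_not_P[OF False] cA by (simp add: P A_def)
    qed
  qed simp
  also have "\<dots> = card (K i) * card A + card {y \<in> S. \<not> (\<forall>j\<in>J. y j = x j)} * card A"
  proof -
    have "(\<Sum>y\<in>S. if \<forall>j\<in>J. y j = x j then (if y = x then card (K i) * card A else 0) else card A) =
        (\<Sum>y\<in>S. (if y = x then card (K i) * card A else 0) +
          (if \<not> (\<forall>j\<in>J. y j = x j) then card A else 0))"
      by (rule sum.cong) auto
    then show ?thesis using finS x by (simp add: sum.distrib sum.If_cases Int_def)
  qed
  finally have "card A * card S = card A * (card (K i) + card {y \<in> S. \<not> (\<forall>j\<in>J. y j = x j)})"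
    by (simp add: algebra_simps)
  moreover have "card A \<noteq> 0" using cA card_ge_2[of i] N by auto
  ultimately have "card S = card (K i) + card {y \<in> S. \<not> (\<forall>j\<in>J. y j = x j)}" by simp
  moreover have "card S = card {y \<in> S. \<forall>j\<in>J. y j = x j} + card {y \<in> S. \<not> (\<forall>j\<in>J. y j = x j)}"
    using finS by (subst card_Un_disjoint[symmetric]) (auto intro: arg_cong[where f = card])
  ultimately have "card {y \<in> S. \<forall>j\<in>J. y j = x j} = card (K i)" by simp
  moreover have "card ((\<lambda>c. x(i := c)) ` K i) = card (K i)"
    by (intro card_image inj_onI) (metis fun_upd_same)
  moreover have "{y \<in> S. \<forall>j\<in>J. y j = x j} \<subseteq> (\<lambda>c. x(i := c)) ` K i"
  proof
    fix y assume y: "y \<in> {y \<in> S. \<forall>j\<in>J. y j = x j}"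
    then have "y = x(i := y i)"
      using x S N by (intro PiE_ext[of y "insert i J" K]) (auto simp: PiE_iff extensional_def subset_iff)
    moreover have "y i \<in> K i" using y S by auto
    ultimately show "y \<in> (\<lambda>c. x(i := c)) ` K i" by blast
  qed
  ultimately have "{y \<in> S. \<forall>j\<in>J. y j = x j} = (\<lambda>c. x(i := c)) ` K i"
    by (intro card_subset_eq) auto
  then show ?thesis using c by blast
qed

text \<open>For the largest index \<open>i\<close>, \<open>S\<close> is a union of full lines in
  direction \<open>i\<close>, hence a product of \<open>K i\<close> and a base. Forms at smaller
  indices do not involve \<open>x i\<close>, so the base inherits the hypothesis.\<close>

lemma equidistributed_trivial:
  assumes "finite I" "I \<subseteq> N" "S \<subseteq> PiE I K"
    and "\<And>i a c. i \<in> I \<Longrightarrow> a \<in> PiE {j \<in> I. j < i} (\<lambda>_. K i) \<Longrightarrow> c \<in> K i \<Longrightarrow>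
      card (K i) * card {x \<in> S. x i + (\<Sum>j\<in>{j \<in> I. j < i}. a j * x j) = c} = card S"
  shows "S = {} \<or> S = PiE I K"
  using assms
proof (induction "card I" arbitrary: I S)
  case 0
  then show ?case by auto
next
  case (Suc n)
  define i where "i = Max I"
  define J where "J = I - {i}"
  have fin: "finite I" and iI: "i \<in> I" and mx: "\<And>j. j \<in> I \<Longrightarrow> j \<le> i"
    using Suc.hyps(2) Suc.prems(1) unfolding i_def by (auto intro: Max_in)
  have I: "I = insert i J" "i \<notin> J" "finite J" using iI fin by (auto simp: J_def)
  have Ji: "{j \<in> I. j < i} = J" using mx by (force simp: J_def)
  have line: "x(i := c) \<in> S" if "x \<in> S" "c \<in> K i" for x c
  proof (rule line_in_equidistributed[OF I(3) _ I(2)])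
    show "insert i J \<subseteq> N" using Suc.prems(2) I by simp
    show "S \<subseteq> PiE (insert i J) K" using Suc.prems(3) I by simp
    show "card (K i) * card {x \<in> S. x i + (\<Sum>j\<in>J. a j * x j) = c} = card S"
      if "a \<in> PiE J (\<lambda>_. K i)" "c \<in> K i" for a c
      using Suc.prems(4)[OF iI, of a c] that Ji by simp
  qed (use that mx I in auto)
  \<comment> \<open>As \<open>S\<close> is a union of lines in direction \<open>i\<close>, any other
    element of \<open>K i\<close> in place of 0 gives the same base.\<close>
  define T where "T = {y \<in> PiE J K. y(i := 0) \<in> S}"
  have K0: "0 \<in> K i" using zero iI Suc.prems(2) by auto
  have cT: "card {x \<in> S. Q x} = card (K i) * card {y \<in> T. Q y}"
    if Q: "\<And>x c. Q (x(i := c)) \<longleftrightarrow> Q x" for Q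
  proof -
    have "bij_betw (\<lambda>(c, y). y(i := c)) (K i \<times> {y \<in> T. Q y}) {x \<in> S. Q x}"
    proof (rule bij_betwI[where g = "\<lambda>x. (x i, x(i := undefined))"])
      show "(\<lambda>(c, y). y(i := c)) \<in> K i \<times> {y \<in> T. Q y} \<rightarrow> {x \<in> S. Q x}"
        using line by (fastforce simp: T_def Q)
      show "(\<lambda>x. (x i, x(i := undefined))) \<in> {x \<in> S. Q x} \<rightarrow> K i \<times> {y \<in> T. Q y}"
      proof
        fix x assume x: "x \<in> {x \<in> S. Q x}"
        then have "x \<in> PiE I K" using Suc.prems(3) by auto
        then have "x i \<in> K i" "x(i := undefined) \<in> PiE J K"
          using iI PiE_upd_undefined[of x I K i] unfolding J_def by auto
        then show "(x i, x(i := undefined)) \<in> K i \<times> {y \<in> T. Q y}"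
          using x line[of x, OF _ K0] by (simp add: T_def Q)
      qed
    qed (auto simp: T_def PiE_iff extensional_def fun_eq_iff I(2))
    then show ?thesis using bij_betw_same_card by (fastforce simp: card_cartesian_product)
  qed
  have Tcard: "card S = card (K i) * card T" using cT[of "\<lambda>_. True"] by simp
  have "T = {} \<or> T = PiE J K"
  proof (rule Suc.hyps(1))
    show "n = card J" using Suc.hyps(2) I by simp
    fix j a c assume j: "j \<in> J" and a: "a \<in> PiE {k \<in> J. k < j} (\<lambda>_. K j)" and c: "c \<in> K j"
    have Jj: "{k \<in> I. k < j} = {k \<in> J. k < j}" using j mx I by force
    let ?Q = "\<lambda>x. x j + (\<Sum>k\<in>{k \<in> J. k < j}. a k * x k) = c"
    have "?Q (x(i := c')) \<longleftrightarrow> ?Q x" for x c'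
    proof -
      have "(\<Sum>k\<in>{k \<in> J. k < j}. a k * (x(i := c')) k) = (\<Sum>k\<in>{k \<in> J. k < j}. a k * x k)"
        using I(2) by (intro sum.cong) auto
      then show ?thesis using j I(2) by auto
    qed
    from cT[of ?Q, OF this]
    have "card (K i) * (card (K j) * card {y \<in> T. ?Q y}) = card S"
      using Suc.prems(4)[of j a c] a c j I Jj by (simp add: mult.left_commute)
    then show "card (K j) * card {y \<in> T. ?Q y} = card T"
      using Tcard K0 by (auto simp: card_eq_0_iff)
  qed (use Suc.prems(2) I in \<open>auto simp: T_def\<close>)
  then show ?case
  proof
    assume "T = {}"
    then have "card S = 0" using Tcard by simp
    then show ?thesis using finite_subset[OF Suc.prems(3)] fin by (simp add: finite_PiE)
  next
    assume T: "T = PiE J K"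
    have "x \<in> S" if x: "x \<in> PiE I K" for x
    proof -
      have "x(i := undefined) \<in> T" using PiE_upd_undefined[OF x] T by (simp add: J_def)
      then have "x(i := 0) \<in> S" by (simp add: T_def)
      from line[OF this, of "x i"] show ?thesis using x iI by auto
    qed
    then show ?thesis using Suc.prems(3) by auto
  qed
qed

end

section \<open>Functions of minimal weight\<close>

context field_tower
begin

abbreviation D :: "nat \<Rightarrow> nat" where "D i \<equiv> card (K i)"

definition min_weight :: "nat set \<Rightarrow> nat \<Rightarrow> ((nat \<Rightarrow> 'a) \<Rightarrow> 'a) \<Rightarrow> bool"
  where "min_weight I d f \<longleftrightarrow>
    polyfun I d f \<and> supp I K f \<noteq> {} \<and> card (supp I K f) = min_prod I D d"

text \<open>\<open>C i\<close> holds the roots in coordinate \<open>i\<close>; it is a proper subset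
  of \<open>K i\<close> so that the product does not vanish on the whole grid. The support of
  \<open>f\<close> after the move is the box with sides \<open>K i - C i\<close>.\<close>

definition factors_as ::
    "nat set \<Rightarrow> nat \<Rightarrow> ((nat \<Rightarrow> 'a) \<Rightarrow> 'a) \<Rightarrow> ((nat \<Rightarrow> 'a) \<Rightarrow> (nat \<Rightarrow> 'a)) \<Rightarrow> 'a \<Rightarrow> (nat \<Rightarrow> 'a set) \<Rightarrow> bool"
  where "factors_as I d f \<phi> \<sigma> C \<longleftrightarrow> moves I K \<phi> \<and> \<sigma> \<noteq> 0 \<and> (\<forall>i\<in>I. C i \<subset> K i) \<and>
    (\<Sum>i\<in>I. card (C i)) \<le> d \<and> (\<forall>x\<in>PiE I K. f (\<phi> x) = \<sigma> * (\<Prod>i\<in>I. \<Prod>c\<in>C i. x i - c))"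

lemma factors_as_moves:
  assumes "factors_as I d (\<lambda>x. f (\<phi> x)) \<psi> \<sigma> C" "moves I K \<phi>"
  shows "factors_as I d f (\<lambda>x. \<phi> (\<psi> x)) \<sigma> C"
  using assms moves.comp[OF assms(2), of \<psi>] by (simp add: factors_as_def)

lemma min_weight_moves:
  assumes "min_weight I d f" "moves I K \<phi>" "I \<subseteq> N"
  shows "min_weight I d (\<lambda>x. f (\<phi> x))"
proof -
  have bij: "bij_betw \<phi> (supp I K (\<lambda>x. f (\<phi> x))) (supp I K f)" by (rule moves_supp[OF assms(2,3)])
  then have "supp I K (\<lambda>x. f (\<phi> x)) \<noteq> {}" using assms(1) by (auto simp: bij_betw_def min_weight_def)
  then show ?thesis
    using assms(1) polyfun_moves[OF _ assms(2)] bij_betw_same_card[OF bij] by (simp add: min_weight_def)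
qed

text \<open>The box on which the product is nonzero has as many points as the product of the
  \<open>D i - card (C i)\<close>, and this must be the minimum weight.\<close>

lemma factors_as_optimal:
  assumes fin: "finite I" and I: "I \<subseteq> N" and m: "min_weight I d f" and p: "factors_as I d f \<phi> \<sigma> C"
  shows "optimal I D d (\<lambda>i. D i - card (C i))"
proof -
  have p': "moves I K \<phi>" "\<sigma> \<noteq> 0" "\<And>i. i \<in> I \<Longrightarrow> C i \<subset> K i" "(\<Sum>i\<in>I. card (C i)) \<le> d"
    "\<And>x. x \<in> PiE I K \<Longrightarrow> f (\<phi> x) = \<sigma> * (\<Prod>i\<in>I. \<Prod>c\<in>C i. x i - c)"
    using p unfolding factors_as_def by auto
  have lt: "card (C i) < D i" if "i \<in> I" for i using p'(3)[OF that] by (simp add: psubset_card_mono)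
  have "(\<Sum>i\<in>I. D i - (D i - card (C i))) = (\<Sum>i\<in>I. card (C i))"
    using lt by (intro sum.cong) (auto simp: less_imp_le)
  then have feas: "feasible I D d (\<lambda>i. D i - card (C i))"
    using lt p'(4) by (auto simp: feasible_def Suc_le_eq)
  have "supp I K (\<lambda>x. f (\<phi> x)) = supp I K (\<lambda>x. \<Prod>i\<in>I. \<Prod>c\<in>C i. x i - c)"
    using p'(2,5) by (auto simp: supp_def)
  also have "\<dots> = PiE I (\<lambda>i. K i - C i)" by (rule supp_box[OF fin])
  finally have "supp I K (\<lambda>x. f (\<phi> x)) = PiE I (\<lambda>i. K i - C i)" .
  then have "card (supp I K f) = card (PiE I (\<lambda>i. K i - C i))"
    using bij_betw_same_card[OF moves_supp[OF p'(1) I, of f]] by simp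
  also have "\<dots> = (\<Prod>i\<in>I. D i - card (C i))"
    using fin p'(3) by (simp add: card_PiE card_Diff_subset psubset_imp_subset)
  finally show ?thesis using m feas by (simp add: min_weight_def optimal_def)
qed

text \<open>Prepares the use of \<open>optimal_gap\<close> to compare the numbers of values of
  different coordinates or forms.\<close>

lemma min_weight_extends:
  assumes fin: "finite I" and I: "I \<subseteq> N" and m: "min_weight I d f" and i: "i \<in> I"
  obtains b where "optimal I D d b" "b i = card ((\<lambda>x. x i) ` supp I K f)"
proof -
  define V where "V = (\<lambda>x. x i) ` supp I K f"
  have m': "polyfun I d f" "supp I K f \<noteq> {}" "card (supp I K f) = min_prod I D d"
    using m by (auto simp: min_weight_def)
  have *: "\<And>b. optimal (I - {i}) D (d - (D i - card V)) b \<Longrightarrow> optimal I D d (b(i := card V))"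
    by (rule minimal_slices[OF fin m' i V_def refl])
  obtain b where "optimal (I - {i}) D (d - (D i - card V)) b"
    by (rule ex_optimal[of "I - {i}" D]) (use I card_ge_2 in \<open>force simp: Suc_le_eq\<close>)+
  from *[OF this] show ?thesis by (intro that[of "b(i := card V)"]) (auto simp: V_def)
qed

lemma min_weight_equidistributed:
  assumes "finite I" "min_weight I d f" "i \<in> I" "v \<in> (\<lambda>x. x i) ` supp I K f"
  shows "card ((\<lambda>x. x i) ` supp I K f) * card {x \<in> supp I K f. x i = v} = card (supp I K f)"
proof -
  have m': "polyfun I d f" "supp I K f \<noteq> {}" "card (supp I K f) = min_prod I D d"
    using assms(2) by (auto simp: min_weight_def)
  show ?thesis by (rule minimal_slices[OF assms(1) m' assms(3) refl refl]) (use assms(4) in blast)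
qed

lemma moves_fixed_coordinate:
  assumes "moves (I - {i}) K \<phi>"
  shows "\<phi> x i = x i"
  using moves_outside[OF assms, of i x "x i"] by (metis DiffD2 fun_upd_same fun_upd_triv singletonI)

text \<open>On \<open>K i\<close> the product of \<open>x i - c\<close> over all \<open>c\<close>
  other than \<open>v\<close> is a multiple of the indicator of \<open>x i = v\<close>. So
  \<open>f\<close> is this product times its only nonzero slice, and the move for that slice leaves
  \<open>x i\<close> alone.\<close>

lemma factors_as_of_slice:
  assumes fin: "finite I" and I: "I \<subseteq> N" and m: "min_weight I d f" and i: "i \<in> I"
    and V: "(\<lambda>x. x i) ` supp I K f = {v}"
    and IH: "\<And>d f. min_weight (I - {i}) d f \<Longrightarrow> \<exists>\<phi> \<sigma> C. factors_as (I - {i}) d f \<phi> \<sigma> C"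
  shows "\<exists>\<phi> \<sigma> C. factors_as I d f \<phi> \<sigma> C"
proof -
  have m': "polyfun I d f" "supp I K f \<noteq> {}" "card (supp I K f) = min_prod I D d"
    using m by (auto simp: min_weight_def)
  have "v \<in> (\<lambda>x. x i) ` supp I K f" using V by simp
  then have vK: "v \<in> K i" using i by (auto simp: supp_def)
  obtain g h where le: "D i - 1 \<le> d" and h: "polyfun (I - {i}) (d - (D i - 1)) (h v)"
    "\<And>x. x \<in> PiE (I - {i}) K \<Longrightarrow> h v x = f (x(i := v))" "supp (I - {i}) K (h v) \<noteq> {}"
    "card (supp (I - {i}) K (h v)) = min_prod (I - {i}) D (d - (D i - 1))"
    by (rule minimal_slices[OF fin m' i V[symmetric] refl]) auto
  then have "min_weight (I - {i}) (d - (D i - 1)) (h v)" by (simp add: min_weight_def)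
  from IH[OF this] obtain \<phi> \<sigma> C where p: "factors_as (I - {i}) (d - (D i - 1)) (h v) \<phi> \<sigma> C"
    by blast
  \<comment> \<open>The value of the product over \<open>K i - {v}\<close> at
    \<open>x i = v\<close>; dividing by it makes that product the indicator of the slice.\<close>
  define \<kappa> where "\<kappa> = (\<Prod>c\<in>K i - {v}. v - c)"
  have \<kappa>: "\<kappa> \<noteq> 0" by (simp add: \<kappa>_def)
  define C' where "C' = C(i := K i - {v})"
  have \<phi>: "moves (I - {i}) K \<phi>" using p by (simp add: factors_as_def)
  then have \<phi>I: "moves I K \<phi>" by (rule moves_mono) auto
  have "factors_as I d f \<phi> (\<sigma> / \<kappa>) C'"
    unfolding factors_as_def
  proof (intro conjI ballI)
    show "moves I K \<phi>" by fact
    show "\<sigma> / \<kappa> \<noteq> 0" using \<kappa> p by (simp add: factors_as_def)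
    show "C' j \<subset> K j" if "j \<in> I" for j using that p vK by (auto simp: factors_as_def C'_def)
    have "(\<Sum>j\<in>I - {i}. card (C' j)) = (\<Sum>j\<in>I - {i}. card (C j))"
      by (intro sum.cong) (auto simp: C'_def)
    moreover have "(\<Sum>j\<in>I - {i}. card (C j)) \<le> d - (D i - 1)" using p by (simp add: factors_as_def)
    moreover have "card (C' i) = D i - 1" using vK by (simp add: C'_def card_Diff_singleton)
    ultimately show "(\<Sum>j\<in>I. card (C' j)) \<le> d" using le fin i by (simp add: sum.remove[of I i])
    fix x assume x: "x \<in> PiE I K"
    have xi: "x i \<in> K i" using x i by auto
    have \<phi>x: "\<phi> x \<in> PiE I K" by (rule moves_PiE[OF \<phi>I I x])
    have rest: "(\<Prod>j\<in>I - {i}. \<Prod>c\<in>C' j. x j - c) = (\<Prod>j\<in>I - {i}. \<Prod>c\<in>C j. x j - c)"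
      by (intro prod.cong) (auto simp: C'_def)
    show "f (\<phi> x) = \<sigma> / \<kappa> * (\<Prod>j\<in>I. \<Prod>c\<in>C' j. x j - c)"
    proof (cases "x i = v")
      case True
      define y where "y = x(i := undefined)"
      have y: "y \<in> PiE (I - {i}) K" unfolding y_def by (rule PiE_upd_undefined[OF x])
      have "\<phi> x = (\<phi> y)(i := v)"
        using moves_outside[OF \<phi>, of i y v] True by (simp add: y_def fun_upd_idem)
      moreover have "\<phi> y \<in> PiE (I - {i}) K" using I by (intro moves_PiE[OF \<phi> _ y]) auto
      ultimately have "f (\<phi> x) = h v (\<phi> y)" using h(2) by simp
      also have "\<dots> = \<sigma> * (\<Prod>j\<in>I - {i}. \<Prod>c\<in>C j. y j - c)" using p y by (simp add: factors_as_def)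
      also have "(\<Prod>j\<in>I - {i}. \<Prod>c\<in>C j. y j - c) = (\<Prod>j\<in>I - {i}. \<Prod>c\<in>C j. x j - c)"
        by (intro prod.cong) (auto simp: y_def)
      finally show ?thesis
        using \<kappa> True rest fin i by (simp add: prod.remove[of I i] C'_def \<kappa>_def)
    next
      case False
      have "f (\<phi> x) = 0"
      proof (rule ccontr)
        assume "f (\<phi> x) \<noteq> 0"
        then have "\<phi> x i = v" using V \<phi>x by (auto simp: supp_def)
        then show False using False moves_fixed_coordinate[OF \<phi>] by simp
      qed
      moreover have "(\<Prod>c\<in>C' i. x i - c) = 0" using xi False by (auto simp: C'_def)
      ultimately show ?thesis using fin i by (simp add: prod.remove[of I i])
    qed
  qed
  then show ?thesis by blast
qed

text \<open>
  \<open>L\<close> is constant on the slice \<open>x i = v\<close> of the support and on one more point, so its slices are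
  larger than those of \<open>x i\<close> and it takes fewer values.
\<close>

lemma factors_as_of_common_hyperplane:
  assumes fin: "finite I" and I: "I \<subseteq> N" and m: "min_weight I d f" and i: "i \<in> I"
    and e: "1 < card ((\<lambda>x. x i) ` supp I K f)" "card ((\<lambda>x. x i) ` supp I K f) < D i"
    and \<psi>: "moves I K \<psi>" and j: "j \<in> I" and L: "\<And>y. L (\<psi> y) = y j"
    and F: "\<And>x. x \<in> supp I K f \<Longrightarrow> x i = v \<Longrightarrow> L x = w"
    and v: "v \<in> (\<lambda>x. x i) ` supp I K f"
    and x': "x' \<in> supp I K f" "x' i \<noteq> v" "L x' = w"
    and IH: "\<And>i d f. i \<in> I \<Longrightarrow> min_weight (I - {i}) d f \<Longrightarrow> \<exists>\<phi> \<sigma> C. factors_as (I - {i}) d f \<phi> \<sigma> C"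
  shows "\<exists>\<phi> \<sigma> C. factors_as I d f \<phi> \<sigma> C"
proof -
  let ?e = "card ((\<lambda>x. x i) ` supp I K f)"
  let ?F = "{x \<in> supp I K f. x i = v}"
  define g where "g x = f (\<psi> x)" for x
  have mg: "min_weight I d g" unfolding g_def by (rule min_weight_moves[OF m \<psi> I])
  have bij: "bij_betw \<psi> (supp I K g) (supp I K f)" unfolding g_def by (rule moves_supp[OF \<psi> I])
  let ?e' = "card ((\<lambda>x. x j) ` supp I K g)"
  let ?G = "{y \<in> supp I K g. y j = w}"
  have fins: "finite (supp I K f)" "finite (supp I K g)" using fin by (simp_all add: supp_def finite_PiE)
  have im: "\<psi> ` ?G = {x \<in> supp I K f. L x = w}"
  proof
    show "\<psi> ` ?G \<subseteq> {x \<in> supp I K f. L x = w}" using bij L by (auto simp: bij_betw_def)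
    show "{x \<in> supp I K f. L x = w} \<subseteq> \<psi> ` ?G"
    proof
      fix x assume x: "x \<in> {x \<in> supp I K f. L x = w}"
      then have "x \<in> \<psi> ` supp I K g" using bij by (simp add: bij_betw_def)
      then obtain y where "y \<in> supp I K g" "\<psi> y = x" by blast
      then show "x \<in> \<psi> ` ?G" using x L[of y] by auto
    qed
  qed
  have "inj_on \<psi> ?G" by (rule inj_on_subset[OF bij_betw_imp_inj_on[OF bij]]) auto
  then have cG: "card ?G = card {x \<in> supp I K f. L x = w}"
    unfolding im[symmetric] by (rule card_image[symmetric])
  have "insert x' ?F \<subseteq> {x \<in> supp I K f. L x = w}" using F x' by auto
  then have "card (insert x' ?F) \<le> card {x \<in> supp I K f. L x = w}"
    using fins by (intro card_mono) auto
  then have lt: "card ?F < card ?G" using cG x' fins by simp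
  then have "?G \<noteq> {}" by (metis card.empty not_less_zero)
  then have w: "w \<in> (\<lambda>x. x j) ` supp I K g" by auto
  \<comment> \<open>Both sides count the support, by equidistribution of \<open>g\<close> along
    \<open>j\<close> and of \<open>f\<close> along \<open>i\<close>.\<close>
  have "?e' * card ?G = ?e * card ?F"
    using min_weight_equidistributed[OF fin mg j w] min_weight_equidistributed[OF fin m i v]
      bij_betw_same_card[OF bij] by simp
  moreover have "?e * card ?F < ?e * card ?G" using lt e(1) by simp
  ultimately have "?e' * card ?G < ?e * card ?G" by simp
  then have less: "?e' < ?e" by simp
  obtain b where b: "optimal I D d b" "b i = ?e" by (rule min_weight_extends[OF fin I m i])
  obtain b' where b': "optimal I D d b'" "b' j = ?e'" by (rule min_weight_extends[OF fin I mg j])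
  \<comment> \<open>\<open>?e\<close> lies strictly between 1 and its bound in one optimal vector,
    and \<open>?e'\<close> is a smaller entry of another.\<close>
  have "b' j = 1"
    by (rule optimal_gap[OF fin b(1) b'(1) i _ _ j]) (use e less b(2) b'(2) in auto)
  then have "?e' = 1" using b'(2) by simp
  then obtain u where "(\<lambda>x. x j) ` supp I K g = {u}" by (metis card_1_singletonE)
  from factors_as_of_slice[OF fin I mg j this IH[OF j]]
  obtain \<phi> \<sigma> C where "factors_as I d g \<phi> \<sigma> C" by blast
  then show ?thesis using factors_as_moves[OF _ \<psi>] unfolding g_def by blast
qed

text \<open>Among the hyperplanes through the flat \<open>x i = v\<close>, \<open>x j = w\<close>,
  one passes through a support point \<open>x'\<close> off the slice. Its form is admissible if the
  coordinate with coefficient 1 belongs to the larger of the two fields; this decides which of the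
  two coefficients is normalised to 1.\<close>

lemma factors_as_of_pencil:
  assumes fin: "finite I" and I: "I \<subseteq> N" and m: "min_weight I d f" and i: "i \<in> I"
    and e: "1 < card ((\<lambda>x. x i) ` supp I K f)" "card ((\<lambda>x. x i) ` supp I K f) < D i"
    and j: "j \<in> I" "j \<noteq> i" and v: "v \<in> (\<lambda>x. x i) ` supp I K f"
    and w: "\<And>x. x \<in> supp I K f \<Longrightarrow> x i = v \<Longrightarrow> x j = w"
    and IH: "\<And>i d f. i \<in> I \<Longrightarrow> min_weight (I - {i}) d f \<Longrightarrow> \<exists>\<phi> \<sigma> C. factors_as (I - {i}) d f \<phi> \<sigma> C"
  shows "\<exists>\<phi> \<sigma> C. factors_as I d f \<phi> \<sigma> C"
proof -
  note common = factors_as_of_common_hyperplane[OF fin I m i e _ _ _ _ v _ _ _ IH]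
  have vK: "v \<in> K i" using v i by (auto simp: supp_def)
  have wK: "w \<in> K j" using v w j by (auto simp: supp_def)
  have "\<exists>x'\<in>supp I K f. x' i \<noteq> v"
  proof (rule ccontr)
    assume "\<not> (\<exists>x'\<in>supp I K f. x' i \<noteq> v)"
    then have "(\<lambda>x. x i) ` supp I K f \<subseteq> {v}" by auto
    then have "card ((\<lambda>x. x i) ` supp I K f) \<le> 1" using card_mono[of "{v}"] by force
    then show False using e by simp
  qed
  then obtain x' where x': "x' \<in> supp I K f" "x' i \<noteq> v" by blast
  have x'K: "x' i \<in> K i" "x' j \<in> K j" using x' i j by (auto simp: supp_def)
  have N: "i \<in> N" "j \<in> N" using I i j by auto
  consider "x' j = w" | "x' j \<noteq> w" "K i \<subseteq> K j" | "x' j \<noteq> w" "K j \<subseteq> K i"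
    using chain[of i j] chain[of j i] N by (metis nat_le_linear)
  then show ?thesis
  proof cases
    case 1
    show ?thesis
      by (rule common[of "\<lambda>x. x" j "\<lambda>x. x j" w x']) (use 1 x' w j in \<open>auto intro: moves.ident\<close>)
  next
    case 2
    \<comment> \<open>Solves \<open>x' j + a * x' i = w + a * v\<close>; the denominator is nonzero
      since \<open>x'\<close> is off the slice.\<close>
    define a where "a = (w - x' j) / (x' i - v)"
    have "a \<in> K j" unfolding a_def using 2 N wK x'K vK by (intro divide diff) auto
    then have mv: "moves I K (\<lambda>y. y(j := y j + - a * y i))"
      using 2 i j N uminus by (intro moves.shear) auto
    show ?thesis
    proof (rule common[OF mv j(1), where L = "\<lambda>x. x j + a * x i" and w = "w + a * v" and x' = x'])
      have "a * (x' i - v) = w - x' j" using x' by (simp add: a_def)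
      then show "x' j + a * x' i = w + a * v" by (simp add: algebra_simps)
    qed (use x' w j in auto)
  next
    case 3
    \<comment> \<open>The same equation with the roles exchanged. Now the denominator is nonzero
      because \<open>x' j = w\<close> was a case of its own.\<close>
    define a where "a = (v - x' i) / (x' j - w)"
    have "a \<in> K i" unfolding a_def using 3 N wK x'K vK by (intro divide diff) auto
    then have mv: "moves I K (\<lambda>y. y(i := y i + - a * y j))"
      using 3 i j N uminus by (intro moves.shear) auto
    show ?thesis
    proof (rule common[OF mv i, where L = "\<lambda>x. x i + a * x j" and w = "v + a * w" and x' = x'])
      have "a * (x' j - w) = v - x' i" using 3 by (simp add: a_def)
      then show "x' i + a * x' j = v + a * w" by (simp add: algebra_simps)
    qed (use x' w j in auto)
  qed
qed

text \<open>A single slice \<open>x i = v\<close> suffices when several occur. By induction it is a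
  box up to a move that fixes \<open>x i\<close>; the optimal vector with \<open>card V\<close> at
  \<open>i\<close> already has an entry strictly between 1 and its bound there, so every side of the
  box is full or a single point.\<close>

lemma factors_as_of_missed_slice:
  assumes fin: "finite I" and I: "I \<subseteq> N" and m: "min_weight I d f" and i: "i \<in> I"
    and lt: "card ((\<lambda>x. x i) ` supp I K f) < D i"
    and IH: "\<And>i d f. i \<in> I \<Longrightarrow> min_weight (I - {i}) d f \<Longrightarrow> \<exists>\<phi> \<sigma> C. factors_as (I - {i}) d f \<phi> \<sigma> C"
  shows "\<exists>\<phi> \<sigma> C. factors_as I d f \<phi> \<sigma> C"
proof -
  define V where "V = (\<lambda>x. x i) ` supp I K f"
  define d' where "d' = d - (D i - card V)"
  have m': "polyfun I d f" "supp I K f \<noteq> {}" "card (supp I K f) = min_prod I D d"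
    using m by (auto simp: min_weight_def)
  have V: "V \<subseteq> K i" "V \<noteq> {}" "0 < card V" using m'(2) i by (auto simp: V_def supp_def card_gt_0_iff)
  show ?thesis
  proof (cases "card V = 1")
    case True
    then obtain v where "V = {v}" by (metis card_1_singletonE)
    then show ?thesis using factors_as_of_slice[OF fin I m i _ IH[OF i]] unfolding V_def by blast
  next
    case False
    then have e: "1 < card V" "card V < D i" using V lt by (auto simp: V_def)
    obtain g h where le: "D i - card V \<le> d" and g: "polyfun I d' g"
      "\<And>x. x \<in> PiE I K \<Longrightarrow> f x = (\<Prod>c\<in>K i - V. x i - c) * g x"
      and h: "\<And>v. v \<in> V \<Longrightarrow> polyfun (I - {i}) d' (h v)"
      "\<And>v x. v \<in> V \<Longrightarrow> x \<in> PiE (I - {i}) K \<Longrightarrow> h v x = f (x(i := v))"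
      "\<And>v. v \<in> V \<Longrightarrow> supp (I - {i}) K (h v) \<noteq> {}"
      "\<And>v. v \<in> V \<Longrightarrow> card (supp (I - {i}) K (h v)) = min_prod (I - {i}) D d'"
      and ext: "\<And>b. optimal (I - {i}) D d' b \<Longrightarrow> optimal I D d (b(i := card V))"
      by (rule minimal_slices[OF fin m' i V_def d'_def]) blast
    obtain v where v: "v \<in> V" using V by auto
    have mh: "min_weight (I - {i}) d' (h v)" using h v by (simp add: min_weight_def)
    from IH[OF i this] obtain \<phi> \<sigma> C where p: "factors_as (I - {i}) d' (h v) \<phi> \<sigma> C" by blast
    have C: "C j \<subset> K j" if "j \<in> I - {i}" for j using p that by (simp add: factors_as_def)
    have \<phi>: "moves (I - {i}) K \<phi>" using p by (simp add: factors_as_def)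
    then have \<phi>I: "moves I K \<phi>" by (rule moves_mono) auto
    define b where "b = (\<lambda>j. D j - card (C j))(i := card V)"
    have b: "optimal I D d b"
      unfolding b_def using fin I by (intro ext factors_as_optimal[OF _ _ mh p]) auto
    have bi: "b i = card V" by (simp add: b_def)
    have dichotomy: "b j = 1 \<or> b j = D j" if j: "j \<in> I - {i}" for j
    proof (rule ccontr)
      assume *: "\<not> (b j = 1 \<or> b j = D j)"
      have "1 \<le> b j" using b j by (auto simp: optimal_def feasible_def)
      then have "1 < b j" using * by simp
      show False
      proof (cases "b i \<le> b j")
        case True
        then show False using optimal_exchange[OF fin b i, of j] j e bi * by auto
      next
        case False
        then show False using optimal_exchange[OF fin b, of j i] i j e bi \<open>1 < b j\<close> by auto
      qed
    qed
    show ?thesis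
    proof (cases "\<forall>j\<in>I - {i}. C j = {}")
      case True
      have "(\<Sum>j\<in>I. D j - b j) = d" using optimal_tight[OF fin b i] e bi by simp
      moreover have "(\<Sum>j\<in>I - {i}. D j - b j) = 0" using True by (simp add: b_def)
      \<comment> \<open>The budget is spent completely, and all of it in coordinate
        \<open>i\<close>, so no degree is left for the quotient \<open>g\<close>.\<close>
      ultimately have "d' = 0" using fin i bi by (simp add: d'_def sum.remove[of I i])
      then obtain a where a: "g = (\<lambda>_. a)" using polyfun_0 g(1) by blast
      define C' where "C' j = (if j = i then K i - V else {})" for j
      have "factors_as I d f (\<lambda>x. x) a C'"
        unfolding factors_as_def
      proof (intro conjI ballI)
        show "moves I K (\<lambda>x. x)" by (rule moves.ident)
        show "a \<noteq> 0" using m'(2) g(2) a by (auto simp: supp_def)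
        show "C' j \<subset> K j" if "j \<in> I" for j using that V I zero by (auto simp: C'_def)
        have "(\<Sum>j\<in>I. card (C' j)) = (\<Sum>j\<in>I. if j = i then card (K i - V) else 0)"
          by (intro sum.cong) (auto simp: C'_def)
        also have "\<dots> = D i - card V" using fin i V by (simp add: card_Diff_subset)
        finally show "(\<Sum>j\<in>I. card (C' j)) \<le> d" using le by simp
        fix x assume x: "x \<in> PiE I K"
        have "(\<Prod>j\<in>I. \<Prod>c\<in>C' j. x j - c) = (\<Prod>j\<in>I. if j = i then \<Prod>c\<in>K i - V. x i - c else 1)"
          by (intro prod.cong) (auto simp: C'_def)
        also have "\<dots> = (\<Prod>c\<in>K i - V. x i - c)" using fin i by simp
        finally show "f x = a * (\<Prod>j\<in>I. \<Prod>c\<in>C' j. x j - c)" using g(2)[OF x] a by simp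
      qed
      then show ?thesis by blast
    next
      case False
      then obtain j where j: "j \<in> I - {i}" "C j \<noteq> {}" by blast
      have "b j \<noteq> D j"
      proof -
        have "0 < card (C j)" "card (C j) \<le> D j"
          using j psubset_imp_subset[OF C[OF j(1)]] by (auto simp: card_gt_0_iff intro: card_mono)
        then show ?thesis using j by (simp add: b_def)
      qed
      then have "b j = 1" using dichotomy[OF j(1)] by blast
      then have "card (K j - C j) = 1"
        using j psubset_imp_subset[OF C[OF j(1)]] by (simp add: b_def card_Diff_subset)
      then obtain w where w: "K j - C j = {w}" by (metis card_1_singletonE)
      define f1 where "f1 x = f (\<phi> x)" for x
      have m1: "min_weight I d f1" unfolding f1_def by (rule min_weight_moves[OF m \<phi>I I])
      have bij: "bij_betw \<phi> (supp I K f1) (supp I K f)" unfolding f1_def by (rule moves_supp[OF \<phi>I I])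
      have "(\<lambda>x. x i) ` supp I K f = (\<lambda>x. x i) ` (\<phi> ` supp I K f1)" using bij by (simp add: bij_betw_def)
      also have "\<dots> = (\<lambda>x. x i) ` supp I K f1" by (simp add: image_image moves_fixed_coordinate[OF \<phi>])
      finally have V1: "(\<lambda>x. x i) ` supp I K f1 = V" by (simp add: V_def)
      have "x j = w" if x: "x \<in> supp I K f1" "x i = v" for x
      proof -
        define y where "y = x(i := undefined)"
        have xP: "x \<in> PiE I K" and fx: "f (\<phi> x) \<noteq> 0" using x by (auto simp: supp_def f1_def)
        have y: "y \<in> PiE (I - {i}) K" unfolding y_def by (rule PiE_upd_undefined[OF xP])
        have "\<phi> x = (\<phi> y)(i := v)"
          using moves_outside[OF \<phi>, of i y v] x(2) by (simp add: y_def fun_upd_idem)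
        moreover have "\<phi> y \<in> PiE (I - {i}) K" using I by (intro moves_PiE[OF \<phi> _ y]) auto
        ultimately have "f (\<phi> x) = h v (\<phi> y)" using h(2)[OF v] by simp
        also have "\<dots> = \<sigma> * (\<Prod>k\<in>I - {i}. \<Prod>c\<in>C k. y k - c)" using p y by (simp add: factors_as_def)
        finally have "(\<Prod>k\<in>I - {i}. \<Prod>c\<in>C k. y k - c) \<noteq> 0" using fx by auto
        then have "y j \<notin> C j" using fin j(1) by auto
        then have "y j \<in> K j - C j" using y j(1) by auto
        then show ?thesis using w j(1) by (simp add: y_def)
      qed
      then obtain \<psi> \<tau> B where "factors_as I d f1 \<psi> \<tau> B"
        using factors_as_of_pencil[OF fin I m1 i, of j v w] e v j IH unfolding V1 by blast
      then show ?thesis using factors_as_moves[OF _ \<phi>I] unfolding f1_def by blast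
    qed
  qed
qed

text \<open>If \<open>d > 0\<close> and \<open>I\<close> is nonempty, one linear factor already
  gives a weight below that of the whole grid; so \<open>d = 0\<close>.\<close>

lemma min_weight_full_support:
  assumes fin: "finite I" and I: "I \<subseteq> N" and m: "min_weight I d f" and full: "supp I K f = PiE I K"
  shows "\<exists>c. f = (\<lambda>_. c)"
proof (cases "I = {}")
  case True
  then show ?thesis using m polyfun_empty[of d f] by (simp add: min_weight_def)
next
  case False
  then obtain i where i: "i \<in> I" by auto
  have D2: "2 \<le> D j" if "j \<in> I" for j using card_ge_2 that I by auto
  have "d = 0"
  proof (rule ccontr)
    assume "d \<noteq> 0"
    define b where "b = D(i := D i - 1)"
    have "(\<Sum>j\<in>I - {i}. D j - b j) = 0" by (simp add: b_def)
    then have "(\<Sum>j\<in>I. D j - b j) = 1" using fin i D2[OF i] by (simp add: sum.remove[of I i] b_def)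
    moreover have "1 \<le> b j \<and> b j \<le> D j" if "j \<in> I" for j using D2[OF that] by (auto simp: b_def)
    ultimately have "feasible I D d b" using \<open>d \<noteq> 0\<close> by (simp add: feasible_def)
    then have "card (supp I K f) \<le> prod b I" using m min_prod_le by (simp add: min_weight_def)
    moreover have "card (supp I K f) = prod D I" using fin by (simp add: full card_PiE)
    moreover have "prod b (I - {i}) = prod D (I - {i})" by (intro prod.cong) (auto simp: b_def)
    moreover have "0 < prod D (I - {i})" using D2 by (intro prod_pos) force
    ultimately have "D i \<le> b i" using fin i by (simp add: prod.remove[of I i])
    then show False using D2[OF i] by (simp add: b_def)
  qed
  then show ?thesis using m polyfun_0[of I f] by (simp add: min_weight_def)
qed

text \<open>If the support is not the whole grid, some form violates equidistribution over its
  field. As a coordinate it must miss a value: if it took all \<open>D i\<close> values, the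
  equality of slice sizes would be exactly that equidistribution.\<close>

theorem min_weight_factors_as:
  assumes "finite I" "I \<subseteq> N" "min_weight I d f"
  shows "\<exists>\<phi> \<sigma> C. factors_as I d f \<phi> \<sigma> C"
  using assms
proof (induction "card I" arbitrary: I d f rule: less_induct)
  case less
  note fin = less.prems(1) and I = less.prems(2) and m = less.prems(3)
  have IH: "\<exists>\<phi> \<sigma> C. factors_as (I - {i}) d f \<phi> \<sigma> C" if "i \<in> I" "min_weight (I - {i}) d f" for i d f
  proof (rule less.hyps[OF _ _ _ that(2)])
    show "card (I - {i}) < card I" using fin that(1) by (rule card_Diff1_less)
  qed (use fin I in auto)
  show ?case
  proof (cases "supp I K f = PiE I K")
    case True
    obtain c where c: "f = (\<lambda>_. c)" using min_weight_full_support[OF fin I m True] by blast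
    have "factors_as I d f (\<lambda>x. x) c (\<lambda>_. {})"
      using m c I zero by (auto simp: factors_as_def min_weight_def supp_def intro: moves.ident)
    then show ?thesis by blast
  next
    case False
    let ?S = "\<lambda>i a c. {x \<in> supp I K f. x i + (\<Sum>j\<in>{j \<in> I. j < i}. a j * x j) = c}"
    have "\<exists>i a c. i \<in> I \<and> a \<in> PiE {j \<in> I. j < i} (\<lambda>_. K i) \<and> c \<in> K i \<and>
        D i * card (?S i a c) \<noteq> card (supp I K f)"
    proof (rule ccontr)
      assume "\<not> ?thesis"
      then have eq: "D i * card (?S i a c) = card (supp I K f)"
        if "i \<in> I" "a \<in> PiE {j \<in> I. j < i} (\<lambda>_. K i)" "c \<in> K i" for i a c
        using that by blast
      have "supp I K f = {} \<or> supp I K f = PiE I K"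
        by (rule equidistributed_trivial[OF fin I _ eq]) (simp add: supp_def)
      then show False using False m by (simp add: min_weight_def)
    qed
    then obtain i a c where i: "i \<in> I" and a: "a \<in> PiE {j \<in> I. j < i} (\<lambda>_. K i)" and c: "c \<in> K i"
      and ne: "D i * card (?S i a c) \<noteq> card (supp I K f)" by (elim exE conjE) (rule that)
    define J where "J = {j \<in> I. j < i}"
    \<comment> \<open>The signs are opposite to those of the form, so that the form takes the value
      \<open>y i\<close> at \<open>\<phi> y\<close>.\<close>
    define \<phi> where "\<phi> x = x(i := x i + (\<Sum>j\<in>J. - a j * x j))" for x :: "nat \<Rightarrow> 'a"
    have \<phi>: "moves I K \<phi>"
      unfolding \<phi>_def
    proof (rule moves_multi_shear)
      show "K j \<subseteq> K i \<and> - a j \<in> K i" if "j \<in> J" for j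
      proof
        have j: "j \<in> I" "j < i" using that by (auto simp: J_def)
        show "K j \<subseteq> K i" using j I i by (intro chain) auto
        have "a j \<in> K i" using PiE_mem[OF a, of j] j by simp
        then show "- a j \<in> K i" using I i by (intro uminus) auto
      qed
    qed (use fin I i in \<open>auto simp: J_def\<close>)
    define g where "g x = f (\<phi> x)" for x
    have mg: "min_weight I d g" unfolding g_def by (rule min_weight_moves[OF m \<phi> I])
    have bij: "bij_betw \<phi> (supp I K g) (supp I K f)" unfolding g_def by (rule moves_supp[OF \<phi> I])
    let ?V = "(\<lambda>x. x i) ` supp I K g"
    have VK: "?V \<subseteq> K i" using i by (auto simp: supp_def)
    have "?V \<noteq> K i"
    proof
      assume V: "?V = K i"
      have L: "\<phi> y i + (\<Sum>j\<in>J. a j * \<phi> y j) = y i" for y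
      proof -
        have "(\<Sum>j\<in>J. a j * \<phi> y j) = (\<Sum>j\<in>J. a j * y j)"
          by (intro sum.cong) (auto simp: \<phi>_def J_def)
        then show ?thesis by (simp add: \<phi>_def sum_negf)
      qed
      have "\<phi> ` {y \<in> supp I K g. y i = c} = {x \<in> supp I K f. x i + (\<Sum>j\<in>J. a j * x j) = c}"
      proof
        show "\<phi> ` {y \<in> supp I K g. y i = c} \<subseteq> {x \<in> supp I K f. x i + (\<Sum>j\<in>J. a j * x j) = c}"
          using bij L by (auto simp: bij_betw_def)
        show "{x \<in> supp I K f. x i + (\<Sum>j\<in>J. a j * x j) = c} \<subseteq> \<phi> ` {y \<in> supp I K g. y i = c}"
        proof
          fix x assume x: "x \<in> {x \<in> supp I K f. x i + (\<Sum>j\<in>J. a j * x j) = c}"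
          then have "x \<in> \<phi> ` supp I K g" using bij by (simp add: bij_betw_def)
          then obtain y where "y \<in> supp I K g" "\<phi> y = x" by blast
          then show "x \<in> \<phi> ` {y \<in> supp I K g. y i = c}" using x L[of y] by auto
        qed
      qed
      moreover have "inj_on \<phi> {y \<in> supp I K g. y i = c}"
        by (rule inj_on_subset[OF bij_betw_imp_inj_on[OF bij]]) auto
      ultimately have "card {x \<in> supp I K f. x i + (\<Sum>j\<in>J. a j * x j) = c} = card {y \<in> supp I K g. y i = c}"
        using card_image by fastforce
      then show False
        using ne min_weight_equidistributed[OF fin mg i, of c] c V bij_betw_same_card[OF bij]
        by (simp add: J_def)
    qed
    then have "card ?V < D i" using VK by (intro psubset_card_mono) auto
    from factors_as_of_missed_slice[OF fin I mg i this IH]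
    obtain \<psi> \<tau> B where "factors_as I d g \<psi> \<tau> B" by blast
    then show ?thesis using factors_as_moves[OF _ \<phi>] unfolding g_def by blast
  qed
qed

end

section \<open>The normal form\<close>

lemma prod_ge_sum:
  fixes b :: "nat \<Rightarrow> nat"
  assumes "finite A" "\<And>i. i \<in> A \<Longrightarrow> 1 \<le> b i"
  shows "1 + (\<Sum>i\<in>A. b i - 1) \<le> prod b A"
  using assms
proof (induction A rule: finite_induct)
  case (insert a A)
  let ?s = "\<Sum>i\<in>A. b i - 1"
  have "b a + ?s \<le> b a * (1 + ?s)" using insert.prems[of a] by simp
  also have "\<dots> \<le> b a * prod b A" using insert by (intro mult_le_mono) auto
  finally have "b a + ?s \<le> b a * prod b A" .
  moreover have "1 \<le> b a" using insert.prems by simp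
  ultimately show ?case using insert.hyps by simp
qed simp

text \<open>Two entries above 1 add a positive cross term (b_i - 1)(b_j - 1) to the product. This is
  what later rules out a second entry above 1.\<close>

lemma prod_gt_sum:
  fixes b :: "nat \<Rightarrow> nat"
  assumes "finite A" "\<And>i. i \<in> A \<Longrightarrow> 1 \<le> b i" "i \<in> A" "j \<in> A" "i \<noteq> j" "1 < b i" "1 < b j"
  shows "1 + (\<Sum>i\<in>A. b i - 1) < prod b A"
proof -
  let ?s = "\<Sum>i\<in>A - {i}. b i - 1"
  have "b j - 1 \<le> ?s" using assms by (intro member_le_sum) auto
  then have s: "1 \<le> ?s" using assms by simp
  have "1 + (\<Sum>i\<in>A. b i - 1) = b i + ?s" using assms by (simp add: sum.remove[of A i])
  also have "\<dots> < b i + b i * ?s" using s assms(6) by simp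
  also have "\<dots> = b i * (1 + ?s)" by simp
  also have "\<dots> \<le> b i * prod b (A - {i})" using assms by (intro mult_le_mono prod_ge_sum) auto
  also have "\<dots> = prod b A" using assms by (simp add: prod.remove[of A i])
  finally show ?thesis .
qed

context field_tower
begin

text \<open>Multiplication by \<open>x\<close> permutes the nonzero elements of \<open>K i\<close>,
  hence preserves their product.\<close>

lemma power_card_minus_1:
  assumes i: "i \<in> N" and x: "x \<in> K i" "x \<noteq> 0"
  shows "x ^ (D i - 1) = 1"
proof -
  let ?G = "K i - {0}"
  have "bij_betw (\<lambda>y. x * y) ?G ?G"
    by (rule bij_betwI[where g = "\<lambda>y. y / x"]) (use i x in \<open>auto intro: mult divide\<close>)
  then have "(\<Prod>y\<in>?G. y) = (\<Prod>y\<in>?G. x * y)" by (rule prod.reindex_bij_betw[symmetric])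
  also have "\<dots> = x ^ (D i - 1) * (\<Prod>y\<in>?G. y)"
    using zero[OF i] by (simp add: prod.distrib card_Diff_singleton)
  finally show ?thesis by simp
qed

lemma factors_as_swap:
  assumes fin: "finite I" and I: "i \<in> I" "j \<in> I" and K: "K i = K j" and p: "factors_as I d f \<phi> \<sigma> C"
  shows "factors_as I d f (\<lambda>x. \<phi> (x(i := x j, j := x i))) \<sigma> (C(i := C j, j := C i))"
proof -
  define \<tau> where "\<tau> = transpose i j"
  have bij: "bij_betw \<tau> I I" using I by (auto simp: \<tau>_def bij_betw_def transpose_image_eq)
  have x\<tau>: "x(i := x j, j := x i) = x \<circ> \<tau>" for x :: "nat \<Rightarrow> 'c"
    by (auto simp: \<tau>_def transpose_def fun_eq_iff)
  have \<tau>\<tau>: "\<tau> (\<tau> m) = m" for m by (simp add: \<tau>_def)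
  have mv: "moves I K (\<lambda>x. x(i := x j, j := x i))" using I K by (rule moves.swap)
  have p': "moves I K \<phi>" "\<sigma> \<noteq> 0" "\<And>i. i \<in> I \<Longrightarrow> C i \<subset> K i" "(\<Sum>i\<in>I. card (C i)) \<le> d"
    "\<And>x. x \<in> PiE I K \<Longrightarrow> f (\<phi> x) = \<sigma> * (\<Prod>i\<in>I. \<Prod>c\<in>C i. x i - c)"
    using p unfolding factors_as_def by auto
  show ?thesis
    unfolding factors_as_def
  proof (intro conjI ballI)
    show "moves I K (\<lambda>x. \<phi> (x(i := x j, j := x i)))" by (rule moves.comp[OF p'(1) mv])
    show "\<sigma> \<noteq> 0" by fact
    show "(C(i := C j, j := C i)) m \<subset> K m" if "m \<in> I" for m
      using p'(3)[of m] p'(3)[of i] p'(3)[of j] I K that by auto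
    have "(\<Sum>m\<in>I. card ((C(i := C j, j := C i)) m)) = (\<Sum>m\<in>I. card (C (\<tau> m)))" unfolding x\<tau> by simp
    also have "\<dots> = (\<Sum>m\<in>I. card (C m))" by (rule sum.reindex_bij_betw[OF bij])
    finally show "(\<Sum>m\<in>I. card ((C(i := C j, j := C i)) m)) \<le> d" using p'(4) by simp
    fix x assume x: "x \<in> PiE I K"
    then have "x \<circ> \<tau> \<in> PiE I K" using I K by (auto simp: x\<tau>[symmetric] PiE_iff extensional_def)
    then have "f (\<phi> (x(i := x j, j := x i))) = \<sigma> * (\<Prod>m\<in>I. \<Prod>c\<in>C m. x (\<tau> m) - c)"
      unfolding x\<tau> by (simp add: p'(5))
    also have "(\<Prod>m\<in>I. \<Prod>c\<in>C m. x (\<tau> m) - c) = (\<Prod>m\<in>I. \<Prod>c\<in>C (\<tau> (\<tau> m)). x (\<tau> m) - c)"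
      by (simp add: \<tau>\<tau>)
    also have "\<dots> = (\<Prod>m\<in>I. \<Prod>c\<in>C (\<tau> m). x m - c)"
      by (rule prod.reindex_bij_betw[OF bij, of "\<lambda>m. \<Prod>c\<in>C (\<tau> m). x m - c"])
    finally show "f (\<phi> (x(i := x j, j := x i))) =
        \<sigma> * (\<Prod>m\<in>I. \<Prod>c\<in>(C(i := C j, j := C i)) m. x m - c)"
      unfolding x\<tau> by (simp add: comp_def)
  qed
qed

lemma moves_multi_translation:
  assumes "finite J" "J \<subseteq> I" "\<And>j. j \<in> J \<Longrightarrow> c j \<in> K j"
  shows "moves I K (\<lambda>x m. if m \<in> J then x m + c m else x m)"
  using assms
proof (induction J rule: finite_induct)
  case empty
  then show ?case by (simp add: moves.ident)
next
  case (insert j J)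
  define g h where "g x = (\<lambda>m. if m \<in> J then x m + c m else x m)" and "h x = x(j := x j + c j)"
    for x :: "nat \<Rightarrow> 'a"
  have "moves I K g" unfolding g_def by (rule insert.IH) (use insert.prems in auto)
  moreover have "moves I K h" unfolding h_def using insert.prems by (intro moves.translation) auto
  ultimately have "moves I K (\<lambda>x. g (h x))" by (rule moves.comp)
  moreover have "g (h x) = (\<lambda>m. if m \<in> insert j J then x m + c m else x m)" for x
    using insert.hyps by (auto simp: g_def h_def fun_eq_iff)
  ultimately show ?case by (simp only:)
qed

end

section \<open>Position of the root sets for the given degree\<close>

locale code_parameters = field_tower K "{..<n}" for K :: "nat \<Rightarrow> 'a::{field, finite} set" and n +
  fixes k l d :: nat
  assumes k: "k < n" and l: "0 < l" "l \<le> card (K k) - 1"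
    and d: "d = (\<Sum>i<k. card (K i) - 1) + l"
begin

text \<open>The coordinates up to \<open>k\<close> could absorb \<open>D k - l - 1\<close> more than
  the budget; the truncated subtractions are exact because \<open>l \<le> D k - 1\<close>.\<close>

lemma sum_upto_k: "(\<Sum>i\<le>k. D i - 1) = d + (D k - l - 1)"
proof -
  have "(\<Sum>i\<le>k. D i - 1) = (\<Sum>i<k. D i - 1) + (D k - 1)"
    by (simp add: lessThan_Suc_atMost[symmetric])
  then show ?thesis using d l by simp
qed

text \<open>The exchange argument would force all entries up to \<open>k\<close> to 1. These alone
  spend at least \<open>d\<close>, and position \<open>i\<close> spends more.\<close>

lemma not_optimal_all_le:
  assumes opt: "optimal {..<n} D d b" and i: "k < i" "i < n" "b i < D i"
    and le: "\<And>x. x \<le> k \<Longrightarrow> b x \<le> b i"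
  shows False
proof -
  have bD: "\<And>x. x < n \<Longrightarrow> 1 \<le> b x \<and> b x \<le> D x" and s: "(\<Sum>x<n. D x - b x) \<le> d"
    using opt by (auto simp: optimal_def feasible_def)
  have one: "b x = 1" if "x \<le> k" for x
  proof (rule ccontr)
    assume "b x \<noteq> 1"
    then have "1 < b x" using bD[of x] that k by auto
    then have "b i = D i" using optimal_exchange[OF _ opt, of x i] le[OF that] that i k by auto
    then show False using i by simp
  qed
  have "(\<Sum>x\<in>insert i {..k}. D x - b x) \<le> (\<Sum>x<n. D x - b x)"
    using k i by (intro sum_mono2) auto
  moreover have "(\<Sum>x\<in>insert i {..k}. D x - b x) = (D i - b i) + (\<Sum>x\<le>k. D x - 1)"
    using i one by simp
  ultimately show False using s sum_upto_k i by simp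
qed

text \<open>Each swap empties one root set beyond \<open>k\<close>. The partner \<open>j\<close> has
  the largest entry among the positions up to \<open>k\<close>; if \<open>b j < D i\<close>,
  exchanging the two entries would give a vector excluded by \<open>not_optimal_all_le\<close>. So
  D_i \<le> b_j \<le> D_j \<le> D_i: the fields coincide and \<open>C j\<close> is empty.\<close>

lemma factors_as_initial:
  assumes m: "min_weight {..<n} d f" and "factors_as {..<n} d f \<phi> \<sigma> C"
  shows "\<exists>\<phi> \<sigma> C. factors_as {..<n} d f \<phi> \<sigma> C \<and> (\<forall>i. k < i \<and> i < n \<longrightarrow> C i = {})"
  using assms(2)
proof (induction "card {i. k < i \<and> i < n \<and> C i \<noteq> {}}" arbitrary: \<phi> C rule: less_induct)
  case less
  note p = less.prems
  show ?case
  proof (cases "\<forall>i. k < i \<and> i < n \<longrightarrow> C i = {}")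
    case True
    then show ?thesis using p by blast
  next
    case False
    then obtain i where i: "k < i" "i < n" "C i \<noteq> {}" by blast
    define b where "b x = D x - card (C x)" for x
    have opt: "optimal {..<n} D d b" unfolding b_def by (rule factors_as_optimal[OF _ _ m p]) auto
    have bD: "\<And>x. x < n \<Longrightarrow> 1 \<le> b x \<and> b x \<le> D x"
      using opt by (auto simp: optimal_def feasible_def)
    have sub: "C x \<subseteq> K x" if "x < n" for x using p that by (auto simp: factors_as_def)
    have pos: "0 < D x" if "x < n" for x using card_ge_2[of x] that by simp
    have bi: "b i < D i" using i sub[of i] pos[of i] by (auto simp: b_def card_gt_0_iff)
    have "finite (b ` {..k})" "b ` {..k} \<noteq> {}" by auto
    then obtain j where j: "j \<le> k" "b j = Max (b ` {..k})"
      using Max_in[of "b ` {..k}"] by (metis atMost_iff imageE)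
    then have max: "b x \<le> b j" if "x \<le> k" for x using that by simp
    have jn: "j < n" "j < i" using j i k by auto
    have bj: "b i < b j" using not_optimal_all_le[OF opt i(1,2) bi] max by (meson le_trans not_less)
    have "\<not> b j < D i"
    proof
      assume lt: "b j < D i"
      have "optimal {..<n} D d (b(i := b j, j := b i))"
        using opt i jn lt bj bD[OF jn(1)] by (intro optimal_swap) auto
      then show False
        by (rule not_optimal_all_le[OF _ i(1,2)]) (use lt i j max bj in \<open>auto simp: less_imp_le\<close>)
    qed
    moreover have KK: "K j \<subseteq> K i" using chain[of j i] jn i by simp
    moreover have "D j \<le> D i" using KK by (intro card_mono) auto
    ultimately have eq: "D j = D i" "b j = D j" using bD[OF jn(1)] by auto
    then have Kji: "K i = K j" using KK card_subset_eq[of "K i" "K j"] by auto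
    have "card (C j) = 0"
      using eq(2)[unfolded b_def] pos[OF jn(1)] by linarith
    then have Cj: "C j = {}" by simp
    have p': "factors_as {..<n} d f (\<lambda>x. \<phi> (x(i := x j, j := x i))) \<sigma> (C(i := C j, j := C i))"
      using i jn by (intro factors_as_swap Kji p) auto
    show ?thesis
    proof (rule less.hyps[OF _ p'], rule psubset_card_mono)
      show "finite {i. k < i \<and> i < n \<and> C i \<noteq> {}}" by simp
      show "{m. k < m \<and> m < n \<and> (C(i := C j, j := C i)) m \<noteq> {}} \<subset> {m. k < m \<and> m < n \<and> C m \<noteq> {}}"
        using i j Cj by auto
    qed
  qed
qed

text \<open>Comparison with the vector that is 1 below \<open>k\<close>, \<open>D k - l\<close> at
  \<open>k\<close> and full beyond bounds the product up to \<open>k\<close> from above by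
  \<open>u\<close>. The budget bounds the sum of the \<open>b x - 1\<close> from below by
  \<open>u - 1\<close>, so the inequality between product and sum is an equality.\<close>

lemma optimal_initial:
  assumes opt: "optimal {..<n} D d b" and full: "\<And>i. k < i \<Longrightarrow> i < n \<Longrightarrow> b i = D i"
  obtains j where "j \<le> k" "b j = D k - l" "\<And>i. i \<le> k \<Longrightarrow> i \<noteq> j \<Longrightarrow> b i = 1"
proof -
  define u where "u = D k - l"
  have u: "1 \<le> u" "u \<le> D k" using l by (auto simp: u_def)
  have bD: "\<And>x. x < n \<Longrightarrow> 1 \<le> b x \<and> b x \<le> D x" and s: "(\<Sum>x<n. D x - b x) \<le> d"
    using opt by (auto simp: optimal_def feasible_def)
  have pos: "1 \<le> D x" if "x < n" for x using card_ge_2[of x] that by simp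
  have split: "{..<n} = {..k} \<union> {k<..<n}" "{..k} \<inter> {k<..<n} = {}" using k by auto
  define c where "c i = (if i < k then 1 else if i = k then u else D i)" for i
  have "(\<Sum>x<n. D x - c x) = (\<Sum>x\<le>k. D x - c x)"
    unfolding split(1) using split(2) by (subst sum.union_disjoint) (auto simp: c_def)
  also have "\<dots> = (\<Sum>x<k. D x - c x) + (D k - c k)" by (simp add: lessThan_Suc_atMost[symmetric])
  also have "\<dots> = d" using l d by (simp add: c_def u_def)
  finally have "feasible {..<n} D d c" using u pos by (auto simp: feasible_def c_def)
  then have "prod b {..<n} \<le> prod c {..<n}" by (rule optimal_le[OF opt])
  moreover have "prod c {..<n} = prod c {..k} * prod D {k<..<n}"
    unfolding split(1) using split(2) by (subst prod.union_disjoint) (auto simp: c_def intro!: prod.cong)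
  moreover have "prod b {..<n} = prod b {..k} * prod D {k<..<n}"
    unfolding split(1) using split(2) full by (subst prod.union_disjoint) auto
  moreover have "prod c {..k} = u" by (simp add: lessThan_Suc_atMost[symmetric] c_def)
  moreover have "0 < prod D {k<..<n}" using pos by (intro prod_pos) force
  ultimately have le: "prod b {..k} \<le> u" by simp
  have "(\<Sum>x\<le>k. D x - b x) \<le> (\<Sum>x<n. D x - b x)" using k by (intro sum_mono2) auto
  then have "(\<Sum>x\<le>k. D x - b x) \<le> d" using s by simp
  moreover have "(\<Sum>x\<le>k. D x - 1) = (\<Sum>x\<le>k. D x - b x) + (\<Sum>x\<le>k. b x - 1)"
    unfolding sum.distrib[symmetric]
  proof (rule sum.cong)
    fix x assume "x \<in> {..k}"
    then show "D x - 1 = D x - b x + (b x - 1)" using bD[of x] k by auto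
  qed simp
  ultimately have ge: "u \<le> 1 + (\<Sum>x\<le>k. b x - 1)" using sum_upto_k u by (simp add: u_def)
  have b1: "1 \<le> b x" if "x \<in> {..k}" for x using bD[of x] that k by auto
  have uniq: "i = j" if "i \<le> k" "j \<le> k" "1 < b i" "1 < b j" for i j
    using prod_gt_sum[of "{..k}" b i j] b1 that le ge by fastforce
  obtain j where j: "j \<le> k" "\<And>i. i \<le> k \<Longrightarrow> i \<noteq> j \<Longrightarrow> b i = 1"
  proof (cases "\<exists>j\<le>k. 1 < b j")
    case True
    then obtain j where "j \<le> k" "1 < b j" by blast
    then show ?thesis using that[of j] uniq b1 by (metis atMost_iff le_neq_implies_less)
  next
    case False
    \<comment> \<open>If all entries are 1, any position can serve as \<open>j\<close>; the value
      \<open>u\<close> is then 1 as well.\<close>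
    then show ?thesis using that[of k] b1 by (metis atMost_iff le_neq_implies_less order_refl)
  qed
  have "prod b {..k} = b j" using j by (simp add: prod.remove[of "{..k}" j])
  moreover have "(\<Sum>x\<le>k. b x - 1) = b j - 1" using j by (simp add: sum.remove[of "{..k}" j])
  ultimately have "b j = u" using le ge b1[of j] j by simp
  then show ?thesis using that j by (simp add: u_def)
qed

text \<open>Apart from \<open>j\<close>, each coordinate up to \<open>k\<close> has one non-root
  \<open>c i\<close>. Translating it to 0 turns the product of the linear factors into a multiple of
  the indicator of 0, which on \<open>K i\<close> is 1 - x_i^(D_i - 1).\<close>

theorem min_weight_normal_form:
  assumes m: "min_weight {..<n} d f"
  obtains \<phi> j \<sigma> a where "moves {..<n} K \<phi>" "j \<le> k" "D k - l \<le> D j" "\<sigma> \<noteq> 0"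
    "inj_on a {1..D j - (D k - l)}" "a ` {1..D j - (D k - l)} \<subseteq> K j"
    "\<And>x. x \<in> PiE {..<n} K \<Longrightarrow> f (\<phi> x) = \<sigma> * (\<Prod>i\<in>{..k} - {j}. 1 - x i ^ (D i - 1)) *
      (\<Prod>t = 1..D j - (D k - l). x j - a t)"
proof -
  obtain \<phi> \<sigma> C where p: "factors_as {..<n} d f \<phi> \<sigma> C"
    and empty: "\<And>i. k < i \<Longrightarrow> i < n \<Longrightarrow> C i = {}"
    using min_weight_factors_as[OF _ _ m] factors_as_initial[OF m] by blast
  have opt: "optimal {..<n} D d (\<lambda>i. D i - card (C i))"
    by (rule factors_as_optimal[OF _ _ m p]) auto
  obtain j where j: "j \<le> k" "D j - card (C j) = D k - l"
    and one: "\<And>i. i \<le> k \<Longrightarrow> i \<noteq> j \<Longrightarrow> D i - card (C i) = 1"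
    by (rule optimal_initial[OF opt]) (use empty in auto)
  have C: "C i \<subset> K i" if "i < n" for i using p that by (simp add: factors_as_def)
  have le: "D k - l \<le> D j" using j(2) by simp
  have "card (C j) \<le> D j" using C[of j] j k by (intro card_mono) auto
  then have cC: "card (C j) = D j - (D k - l)" using j by simp
  obtain a where a: "bij_betw a {1..card (C j)} (C j)"
    using ex_bij_betw_nat_finite_1[of "C j"] by auto
  have "\<exists>c. K i - C i = {c}" if "i \<in> {..k} - {j}" for i
  proof -
    have "card (K i - C i) = 1"
      using one[of i] that k C[of i] by (simp add: card_Diff_subset psubset_imp_subset)
    then show ?thesis by (metis card_1_singletonE)
  qed
  then obtain c where c: "\<And>i. i \<in> {..k} - {j} \<Longrightarrow> K i - C i = {c i}" by metis
  have cK: "c i \<in> K i" "C i = K i - {c i}" if i: "i \<in> {..k} - {j}" for i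
  proof -
    show "c i \<in> K i" using c[OF i] by blast
    have "C i \<subseteq> K i" using C[of i] i k by auto
    then show "C i = K i - {c i}" using double_diff[of "C i" "K i" "K i"] c[OF i] by simp
  qed
  define \<tau> where "\<tau> x m = (if m \<in> {..k} - {j} then x m + c m else x m)" for x m
  have \<tau>: "moves {..<n} K \<tau>"
    unfolding \<tau>_def using k cK by (intro moves_multi_translation) auto
  \<comment> \<open>The value at \<open>c i\<close>, that is, at 0 after the translation.\<close>
  define \<kappa> where "\<kappa> i = (\<Prod>y\<in>C i. c i - y)" for i
  have \<kappa>: "\<kappa> i \<noteq> 0" if "i \<in> {..k} - {j}" for i using cK[OF that] by (simp add: \<kappa>_def)
  have factor: "(\<Prod>y\<in>C i. x + c i - y) = \<kappa> i * (1 - x ^ (D i - 1))"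
    if i: "i \<in> {..k} - {j}" and x: "x \<in> K i" for i x
  proof (cases "x = 0")
    case True
    then show ?thesis using card_ge_2[of i] i k by (simp add: \<kappa>_def power_0_left)
  next
    case False
    have iN: "i \<in> {..<n}" using i k by auto
    have "x + c i \<in> C i" using cK[OF i] add[OF iN x] False by simp
    then have "(\<Prod>y\<in>C i. x + c i - y) = 0" by auto
    then show ?thesis using power_card_minus_1[OF iN x False] by simp
  qed
  show ?thesis
  proof (rule that[of "\<lambda>x. \<phi> (\<tau> x)" j "\<sigma> * (\<Prod>i\<in>{..k} - {j}. \<kappa> i)" a])
    show "moves {..<n} K (\<lambda>x. \<phi> (\<tau> x))" using p \<tau> by (auto simp: factors_as_def intro: moves.comp)
    show "\<sigma> * (\<Prod>i\<in>{..k} - {j}. \<kappa> i) \<noteq> 0" using p \<kappa> by (simp add: factors_as_def)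
    show "inj_on a {1..D j - (D k - l)}" using a cC by (simp add: bij_betw_def)
    show "a ` {1..D j - (D k - l)} \<subseteq> K j" using a cC C[of j] j k by (auto simp: bij_betw_def)
    fix x assume x: "x \<in> PiE {..<n} K"
    have "\<tau> x \<in> PiE {..<n} K" by (rule moves_PiE[OF \<tau> _ x]) simp
    then have "f (\<phi> (\<tau> x)) = \<sigma> * (\<Prod>i<n. \<Prod>y\<in>C i. \<tau> x i - y)" using p by (simp add: factors_as_def)
    also have "(\<Prod>i<n. \<Prod>y\<in>C i. \<tau> x i - y) = (\<Prod>i\<le>k. \<Prod>y\<in>C i. \<tau> x i - y)"
      using k empty by (intro prod.mono_neutral_right) auto
    also have "\<dots> = (\<Prod>y\<in>C j. \<tau> x j - y) * (\<Prod>i\<in>{..k} - {j}. \<Prod>y\<in>C i. \<tau> x i - y)"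
      by (rule prod.remove) (use j in auto)
    also have "(\<Prod>i\<in>{..k} - {j}. \<Prod>y\<in>C i. \<tau> x i - y) =
        (\<Prod>i\<in>{..k} - {j}. \<kappa> i * (1 - x i ^ (D i - 1)))"
    proof (rule prod.cong)
      fix i assume i: "i \<in> {..k} - {j}"
      then have "x i \<in> K i" using k by (intro PiE_mem[OF x]) auto
      from factor[OF i this] show "(\<Prod>y\<in>C i. \<tau> x i - y) = \<kappa> i * (1 - x i ^ (D i - 1))"
        unfolding \<tau>_def if_P[OF i] .
    qed simp
    also have "\<dots> = (\<Prod>i\<in>{..k} - {j}. \<kappa> i) * (\<Prod>i\<in>{..k} - {j}. 1 - x i ^ (D i - 1))"
      by (rule prod.distrib)
    also have "(\<Prod>y\<in>C j. \<tau> x j - y) = (\<Prod>t = 1..card (C j). x j - a t)"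
      unfolding prod.reindex_bij_betw[OF a, symmetric] by (simp add: \<tau>_def)
    finally show "f (\<phi> (\<tau> x)) = \<sigma> * (\<Prod>i\<in>{..k} - {j}. \<kappa> i) *
        (\<Prod>i\<in>{..k} - {j}. 1 - x i ^ (D i - 1)) * (\<Prod>t = 1..D j - (D k - l). x j - a t)"
      using cC by (simp add: ac_simps)
  qed (use j le in auto)
qed

end

section \<open>Reduced polynomials and codewords\<close>

lemma polyfun_linear: "i \<in> I \<Longrightarrow> polyfun I 1 (\<lambda>x. x i - c)"
  using polyfun.add[OF polyfun_var polyfun.const[of I 1 "- c"]] by simp

lemma polyfun_box:
  fixes C :: "nat \<Rightarrow> 'a::{field, finite} set"
  assumes "finite I"
  shows "polyfun I (\<Sum>i\<in>I. card (C i)) (\<lambda>x. \<Prod>i\<in>I. \<Prod>c\<in>C i. x i - c)"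
proof (rule polyfun_prod[OF assms])
  fix i assume i: "i \<in> I"
  show "polyfun I (card (C i)) (\<lambda>x. \<Prod>c\<in>C i. x i - c)"
    using polyfun_prod[of "C i" I "\<lambda>_. 1" "\<lambda>c x. x i - c", OF _ polyfun_linear[OF i]] by simp
qed

text \<open>Lagrange interpolation. Each basis function has all field elements but one as roots in
  every coordinate; the resulting degree is crude, but only the existence of some bound
  matters.\<close>

lemma polyfun_interpolation:
  fixes f :: "(nat \<Rightarrow> 'a::{field, finite}) \<Rightarrow> 'a"
  assumes fin: "finite I"
  obtains d g where "polyfun I d g" "\<And>x. x \<in> PiE I K \<Longrightarrow> g x = f x"
proof -
  define B where "B y x = (\<Prod>i\<in>I. \<Prod>c\<in>- {y i}. x i - c)" for x y :: "nat \<Rightarrow> 'a"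
  have finX: "finite (PiE I K)" using fin by (simp add: finite_PiE)
  have B0: "B y x \<noteq> 0 \<longleftrightarrow> x = y" if "x \<in> PiE I K" "y \<in> PiE I K" for x y
  proof -
    have "B y x \<noteq> 0 \<longleftrightarrow> (\<forall>i\<in>I. x i = y i)" using fin by (auto simp: B_def)
    also have "\<dots> \<longleftrightarrow> x = y" using that by (auto intro: PiE_ext)
    finally show ?thesis .
  qed
  define g where "g x = (\<Sum>y\<in>PiE I K. f y / B y y * B y x)" for x
  have "polyfun I (\<Sum>i\<in>I. card (UNIV :: 'a set)) g"
    unfolding g_def B_def
    by (intro polyfun_sum polyfun_cmult polyfun_mono[OF polyfun_box[OF fin]] sum_mono card_mono) auto
  moreover have "g x = f x" if x: "x \<in> PiE I K" for x
  proof -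
    have "g x = (\<Sum>y\<in>PiE I K. if y = x then f x else 0)"
      unfolding g_def using B0[OF x] B0[OF x x] by (intro sum.cong) auto
    then show ?thesis using finX x by simp
  qed
  ultimately show ?thesis by (rule that)
qed

section \<open>Existence, uniqueness and degree of reduced polynomials\<close>

locale finite_tower = field_tower K "{..<n}" for K :: "nat \<Rightarrow> 'a::{field, finite} set" and n
begin

abbreviation points :: "(nat \<Rightarrow> 'a) set" where "points \<equiv> PiE {..<n} K"

abbreviation degree_of :: "(nat \<Rightarrow>\<^sub>0 nat) \<Rightarrow> nat"
  where "degree_of m \<equiv> (\<Sum>i<n. Poly_Mapping.lookup m i)"

definition exponents :: "(nat \<Rightarrow>\<^sub>0 nat) set"
  where "exponents =
    {m. Poly_Mapping.keys m \<subseteq> {..<n} \<and> (\<forall>i<n. Poly_Mapping.lookup m i < D i)}"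

definition monom_fun :: "(nat \<Rightarrow>\<^sub>0 nat) \<Rightarrow> (nat \<Rightarrow> 'a) \<Rightarrow> 'a"
  where "monom_fun m x = (\<Prod>i<n. x i ^ Poly_Mapping.lookup m i)"

text \<open>The equality of cardinalities will turn surjectivity of evaluation into uniqueness of
  the reduced polynomial.\<close>

lemma card_exponents: "finite exponents" "card exponents = card points"
proof -
  let ?B = "PiE {..<n} (\<lambda>i. {..<D i})"
  have bij: "bij_betw (\<lambda>m. restrict (Poly_Mapping.lookup m) {..<n}) exponents ?B"
  proof (rule bij_betwI[where g = "\<lambda>e. Abs_poly_mapping (\<lambda>i. if i < n then e i else 0)"])
    have lookup: "Poly_Mapping.lookup (Abs_poly_mapping (\<lambda>i. if i < n then e i else 0)) =
        (\<lambda>i. if i < n then e i else 0)" for e :: "nat \<Rightarrow> nat"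
      by (rule lookup_Abs_poly_mapping) (rule finite_subset[of _ "{..<n}"], auto)
    show "(\<lambda>m. restrict (Poly_Mapping.lookup m) {..<n}) \<in> exponents \<rightarrow> ?B"
      by (auto simp: exponents_def)
    show "(\<lambda>e. Abs_poly_mapping (\<lambda>i. if i < n then e i else 0)) \<in> ?B \<rightarrow> exponents"
    proof
      fix e assume e: "e \<in> ?B"
      have "Poly_Mapping.keys (Abs_poly_mapping (\<lambda>i. if i < n then e i else 0)) \<subseteq> {..<n}"
        unfolding subset_iff in_keys_iff lookup by simp
      then show "Abs_poly_mapping (\<lambda>i. if i < n then e i else 0) \<in> exponents"
        using PiE_mem[OF e] by (simp add: exponents_def lookup)
    qed
    show "Abs_poly_mapping (\<lambda>i. if i < n then restrict (Poly_Mapping.lookup m) {..<n} i else 0) = m"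
      if m: "m \<in> exponents" for m
    proof (rule poly_mapping_eqI)
      fix i
      have "Poly_Mapping.lookup m i = 0" if "\<not> i < n"
        using that m by (auto simp: exponents_def simp flip: not_in_keys_iff_lookup_eq_zero)
      then show "Poly_Mapping.lookup (Abs_poly_mapping
          (\<lambda>i. if i < n then restrict (Poly_Mapping.lookup m) {..<n} i else 0)) i = Poly_Mapping.lookup m i"
        unfolding lookup by simp
    qed
    show "restrict (Poly_Mapping.lookup (Abs_poly_mapping (\<lambda>i. if i < n then e i else 0))) {..<n} = e"
      if e: "e \<in> ?B" for e
    proof
      fix i
      show "restrict (Poly_Mapping.lookup (Abs_poly_mapping (\<lambda>i. if i < n then e i else 0))) {..<n} i = e i"
        unfolding lookup using PiE_arb[OF e, of i] by simp
    qed
  qed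
  show "finite exponents" using bij_betw_finite[OF bij] by (simp add: finite_PiE)
  show "card exponents = card points" using bij_betw_same_card[OF bij] by (simp add: card_PiE)
qed

text \<open>Every element of \<open>K i\<close> equals its \<open>D i\<close>-th power, so an
  exponent that would reach \<open>D i\<close> drops to 1. It cannot drop to 0, as
  \<open>x i\<close> may vanish.\<close>

lemma var_times_monom_fun:
  assumes m: "m \<in> exponents" and i: "i < n"
  shows "\<exists>m'\<in>exponents. degree_of m' \<le> Suc (degree_of m) \<and>
    (\<forall>x\<in>points. x i * monom_fun m x = monom_fun m' x)"
proof -
  let ?e = "Poly_Mapping.lookup m i"
  define v where "v = (if Suc ?e < D i then Suc ?e else 1)"
  define m' where "m' = Poly_Mapping.update i v m"
  have D2: "2 \<le> D i" using card_ge_2 i by simp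
  have mi: "Poly_Mapping.lookup m' i = v"
    and mj: "\<And>j. j \<noteq> i \<Longrightarrow> Poly_Mapping.lookup m' j = Poly_Mapping.lookup m j"
    by (simp_all add: m'_def lookup_update)
  have "m' \<in> exponents"
    using m i D2 by (auto simp: exponents_def m'_def keys_update lookup_update v_def split: if_splits)
  moreover have "degree_of m' \<le> Suc (degree_of m)"
  proof -
    have "(\<Sum>j\<in>{..<n} - {i}. Poly_Mapping.lookup m' j) = (\<Sum>j\<in>{..<n} - {i}. Poly_Mapping.lookup m j)"
      by (intro sum.cong) (auto simp: mj)
    then show ?thesis using i by (simp add: sum.remove[of "{..<n}" i] mi v_def)
  qed
  moreover have "x i * monom_fun m x = monom_fun m' x" if x: "x \<in> points" for x
  proof -
    have xK: "x i \<in> K i" using PiE_mem[OF x] i by simp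
    have "x i ^ D i = x i"
    proof (cases "x i = 0")
      case False
      have "Suc (D i - 1) = D i" using D2 by simp
      then have "x i ^ D i = x i * x i ^ (D i - 1)" by (metis power_Suc)
      then show ?thesis using power_card_minus_1[of i "x i"] i xK False by simp
    qed (use D2 in simp)
    moreover have "Suc ?e = D i" if "\<not> Suc ?e < D i" using that m i by (auto simp: exponents_def)
    ultimately have "x i * x i ^ ?e = x i ^ v" unfolding v_def power_Suc[symmetric] by (metis power_one_right)
    moreover have "(\<Prod>j\<in>{..<n} - {i}. x j ^ Poly_Mapping.lookup m' j) =
        (\<Prod>j\<in>{..<n} - {i}. x j ^ Poly_Mapping.lookup m j)"
      by (intro prod.cong) (auto simp: mj)
    ultimately show ?thesis
      using i by (simp add: monom_fun_def prod.remove[of "{..<n}" i] mi mult.assoc[symmetric])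
  qed
  ultimately show ?thesis by blast
qed

lemma polyfun_coeffs:
  assumes "polyfun {..<n} d f"
  shows "\<exists>a. (\<forall>m. a m \<noteq> 0 \<longrightarrow> m \<in> exponents \<and> degree_of m \<le> d) \<and>
    (\<forall>x\<in>points. f x = (\<Sum>m\<in>exponents. a m * monom_fun m x))"
  using assms
proof (induction rule: polyfun.induct)
  case (const d c)
  have "0 \<in> exponents" using card_ge_2 by (force simp: exponents_def)
  moreover have "c = (\<Sum>m\<in>exponents. (if m = 0 then c else 0) * monom_fun m x)" for x
  proof -
    have "(\<Sum>m\<in>exponents. (if m = 0 then c else 0) * monom_fun m x) =
        (\<Sum>m\<in>exponents. if m = 0 then c else 0)"
      by (intro sum.cong) (auto simp: monom_fun_def)
    then show ?thesis using \<open>0 \<in> exponents\<close> card_exponents(1) by simp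
  qed
  ultimately show ?case
    by (intro exI[of _ "\<lambda>m. if m = 0 then c else 0"] conjI allI impI ballI) (simp_all split: if_splits)
next
  case (add d f g)
  from add.IH(1) obtain a where a: "\<And>m. a m \<noteq> 0 \<Longrightarrow> m \<in> exponents \<and> degree_of m \<le> d"
    "\<And>x. x \<in> points \<Longrightarrow> f x = (\<Sum>m\<in>exponents. a m * monom_fun m x)" by blast
  from add.IH(2) obtain b where b: "\<And>m. b m \<noteq> 0 \<Longrightarrow> m \<in> exponents \<and> degree_of m \<le> d"
    "\<And>x. x \<in> points \<Longrightarrow> g x = (\<Sum>m\<in>exponents. b m * monom_fun m x)" by blast
  show ?case
  proof (intro exI[of _ "\<lambda>m. a m + b m"] conjI allI impI ballI)
    fix m assume "a m + b m \<noteq> 0"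
    then have "a m \<noteq> 0 \<or> b m \<noteq> 0" by auto
    then show "m \<in> exponents" "degree_of m \<le> d" using a(1) b(1) by blast+
  qed (simp add: a(2) b(2) distrib_right sum.distrib)
next
  case (var d f i)
  from var.IH obtain a where a: "\<And>m. a m \<noteq> 0 \<Longrightarrow> m \<in> exponents \<and> degree_of m \<le> d"
    "\<And>x. x \<in> points \<Longrightarrow> f x = (\<Sum>m\<in>exponents. a m * monom_fun m x)" by blast
  obtain s where s: "\<And>m. m \<in> exponents \<Longrightarrow> s m \<in> exponents"
    "\<And>m. m \<in> exponents \<Longrightarrow> degree_of (s m) \<le> Suc (degree_of m)"
    "\<And>m x. m \<in> exponents \<Longrightarrow> x \<in> points \<Longrightarrow> x i * monom_fun m x = monom_fun (s m) x"
  proof -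
    have "\<forall>m\<in>exponents. \<exists>m'. m' \<in> exponents \<and> degree_of m' \<le> Suc (degree_of m) \<and>
        (\<forall>x\<in>points. x i * monom_fun m x = monom_fun m' x)"
      using var_times_monom_fun[of _ i] var.hyps(2) by blast
    from bchoice[OF this] show ?thesis using that by blast
  qed
  \<comment> \<open>Different monomials may have the same reduced product with \<open>x i\<close>,
    so coefficients add up along the fibres of \<open>s\<close>.\<close>
  define b where "b m' = (\<Sum>m\<in>{m \<in> exponents. s m = m'}. a m)" for m'
  show ?case
  proof (intro exI[of _ b] conjI allI impI ballI)
    fix m' assume "b m' \<noteq> 0"
    then obtain m where m: "m \<in> {m \<in> exponents. s m = m'}" "a m \<noteq> 0"
      unfolding b_def by (rule sum.not_neutral_contains_not_neutral)
    then show "m' \<in> exponents" using s(1) by auto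
    show "degree_of m' \<le> Suc d" using m s(2)[of m] a(1)[OF m(2)] by auto
  next
    fix x assume x: "x \<in> points"
    have "x i * f x = (\<Sum>m\<in>exponents. a m * (x i * monom_fun m x))"
      by (simp add: a(2)[OF x] sum_distrib_left mult.left_commute)
    also have "\<dots> = (\<Sum>m\<in>exponents. a m * monom_fun (s m) x)"
      using s(3) x by (intro sum.cong) auto
    also have "\<dots> = (\<Sum>m'\<in>exponents. \<Sum>m\<in>{m \<in> exponents. s m = m'}. a m * monom_fun (s m) x)"
      using s(1) by (intro sum.group[symmetric] card_exponents) auto
    also have "\<dots> = (\<Sum>m'\<in>exponents. b m' * monom_fun m' x)"
      unfolding b_def sum_distrib_right by (intro sum.cong) auto
    finally show "x i * f x = (\<Sum>m'\<in>exponents. b m' * monom_fun m' x)" .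
  qed
qed

text \<open>
  The evaluation map is onto by interpolation, and there are as many coefficient vectors as
  functions, so it is also injective.
\<close>

lemma coeffs_unique:
  assumes a: "\<And>m. m \<notin> exponents \<Longrightarrow> a m = 0" and b: "\<And>m. m \<notin> exponents \<Longrightarrow> b m = 0"
    and eq: "\<And>x. x \<in> points \<Longrightarrow>
      (\<Sum>m\<in>exponents. a m * monom_fun m x) = (\<Sum>m\<in>exponents. b m * monom_fun m x)"
  shows "a = b"
proof -
  define \<Phi> where "\<Phi> a = (\<lambda>x\<in>points. \<Sum>m\<in>exponents. a m * monom_fun m x)" for a
  let ?A = "exponents \<rightarrow>\<^sub>E (UNIV :: 'a set)" and ?B = "points \<rightarrow>\<^sub>E (UNIV :: 'a set)"
  have finp: "finite points" by (simp add: finite_PiE)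
  have "\<Phi> ` ?A = ?B"
  proof
    show "\<Phi> ` ?A \<subseteq> ?B" unfolding \<Phi>_def by (intro image_subsetI restrict_PiE_iff[THEN iffD2]) simp
    show "?B \<subseteq> \<Phi> ` ?A"
    proof
      fix f assume f: "f \<in> ?B"
      obtain d g where g: "polyfun {..<n} d g" "\<And>x. x \<in> points \<Longrightarrow> g x = f x"
        by (rule polyfun_interpolation[of "{..<n}" K f]) auto
      obtain c where c: "\<And>x. x \<in> points \<Longrightarrow> g x = (\<Sum>m\<in>exponents. c m * monom_fun m x)"
        using polyfun_coeffs[OF g(1)] by blast
      have "\<Phi> (restrict c exponents) = f"
      proof
        fix x
        show "\<Phi> (restrict c exponents) x = f x"
          using g(2)[of x] c[of x] PiE_arb[OF f, of x] by (cases "x \<in> points") (auto simp: \<Phi>_def)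
      qed
      then show "f \<in> \<Phi> ` ?A" by (intro image_eqI[of _ _ "restrict c exponents"]) auto
    qed
  qed
  then have "card (\<Phi> ` ?A) = card ?A" by (simp add: card_funcsetE card_exponents finp)
  then have inj: "inj_on \<Phi> ?A"
    by (intro eq_card_imp_inj_on) (simp_all add: finite_PiE card_exponents)
  have eq': "\<Phi> (restrict a exponents) = \<Phi> (restrict b exponents)"
    using eq by (auto simp: \<Phi>_def)
  have "restrict a exponents = restrict b exponents" 
    by (rule inj_onD[where f = \<Phi>, OF inj eq']) simp_all
  then have "a m = b m" for m using a[of m] b[of m] by (cases "m \<in> exponents") (metis restrict_apply', simp)
  then show ?thesis ..
qed

lemma reduced_iff: "reduced n K P \<longleftrightarrow> Poly_Mapping.keys P \<subseteq> exponents"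
  by (auto simp: reduced_def exponents_def)

lemma monom_fun_keys:
  assumes "m \<in> exponents"
  shows "(\<Prod>i\<in>Poly_Mapping.keys m. vec n x $ i ^ Poly_Mapping.lookup m i) = monom_fun m x"
proof -
  have "(\<Prod>i\<in>Poly_Mapping.keys m. vec n x $ i ^ Poly_Mapping.lookup m i) =
      (\<Prod>i<n. vec n x $ i ^ Poly_Mapping.lookup m i)"
    using assms by (intro prod.mono_neutral_left) (auto simp: exponents_def in_keys_iff)
  then show ?thesis by (simp add: monom_fun_def)
qed

lemma degree_of_keys:
  assumes "m \<in> exponents"
  shows "(\<Sum>i\<in>Poly_Mapping.keys m. Poly_Mapping.lookup m i) = degree_of m"
  using assms by (intro sum.mono_neutral_left) (auto simp: exponents_def in_keys_iff)

lemma eval_mpoly_reduced: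
  assumes "reduced n K P"
  shows "eval_mpoly P (vec n x) = (\<Sum>m\<in>exponents. Poly_Mapping.lookup P m * monom_fun m x)"
proof -
  have "eval_mpoly P (vec n x) = (\<Sum>m\<in>Poly_Mapping.keys P. Poly_Mapping.lookup P m * monom_fun m x)"
    unfolding eval_mpoly_def using assms by (intro sum.cong) (auto simp: reduced_iff monom_fun_keys)
  also have "\<dots> = (\<Sum>m\<in>exponents. Poly_Mapping.lookup P m * monom_fun m x)"
    using assms card_exponents(1) by (intro sum.mono_neutral_left) (auto simp: reduced_iff in_keys_iff)
  finally show ?thesis .
qed

lemma total_degree_le_iff:
  assumes "reduced n K P"
  shows "total_degree P \<le> d \<longleftrightarrow> (\<forall>m\<in>Poly_Mapping.keys P. degree_of m \<le> d)"
proof -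
  have "(\<lambda>m. \<Sum>i\<in>Poly_Mapping.keys m. Poly_Mapping.lookup m i) ` Poly_Mapping.keys P =
      degree_of ` Poly_Mapping.keys P"
    using assms by (intro image_cong refl degree_of_keys) (auto simp: reduced_iff)
  then show ?thesis by (simp add: total_degree_def)
qed

lemma cartesian_eq: "cartesian n K = vec n ` points"
proof (intro subset_antisym subsetI)
  fix \<alpha> assume "\<alpha> \<in> vec n ` points"
  then obtain x where "\<alpha> = vec n x" "x \<in> points" by blast
  then show "\<alpha> \<in> cartesian n K" by (simp add: cartesian_def PiE_mem)
next
  fix \<alpha> assume \<alpha>: "\<alpha> \<in> cartesian n K"
  then have "\<alpha> = vec n (\<lambda>i\<in>{..<n}. \<alpha> $ i)" by (intro eq_vecI) (auto simp: cartesian_def)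
  moreover have "(\<lambda>i\<in>{..<n}. \<alpha> $ i) \<in> points" using \<alpha> by (auto simp: cartesian_def)
  ultimately show "\<alpha> \<in> vec n ` points" by blast
qed

lemma inj_on_vec: "inj_on (vec n) points"
proof (rule inj_onI)
  fix x y assume x: "x \<in> points" and y: "y \<in> points" and eq: "vec n x = vec n y"
  have "x i = y i" if "i < n" for i using arg_cong[OF eq, of "\<lambda>v. v $ i"] that by simp
  then show "x = y" by (intro PiE_ext[OF x y]) auto
qed

text \<open>Uniqueness of the coefficients makes the definite description behind
  \<open>reduced_polynomial\<close> computable.\<close>

lemma reduced_polynomial_eqI:
  assumes P: "reduced n K P" and eq: "\<And>x. x \<in> points \<Longrightarrow> eval_mpoly P (vec n x) = F (vec n x)"
  shows "reduced_polynomial n K F = P"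
  unfolding reduced_polynomial_def
proof (rule the_equality)
  show "reduced n K P \<and> (\<forall>\<alpha>\<in>cartesian n K. eval_mpoly P \<alpha> = F \<alpha>)"
    using P eq by (auto simp: cartesian_eq)
  fix Q assume Q: "reduced n K Q \<and> (\<forall>\<alpha>\<in>cartesian n K. eval_mpoly Q \<alpha> = F \<alpha>)"
  have "Poly_Mapping.lookup Q = Poly_Mapping.lookup P"
  proof (rule coeffs_unique)
    show "Poly_Mapping.lookup Q m = 0" "Poly_Mapping.lookup P m = 0" if "m \<notin> exponents" for m
      using that P Q by (auto simp: reduced_iff in_keys_iff subset_iff)
    fix x assume x: "x \<in> points"
    then have "eval_mpoly Q (vec n x) = eval_mpoly P (vec n x)" using eq Q by (simp add: cartesian_eq)
    then show "(\<Sum>m\<in>exponents. Poly_Mapping.lookup Q m * monom_fun m x) =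
        (\<Sum>m\<in>exponents. Poly_Mapping.lookup P m * monom_fun m x)"
      using P Q by (simp add: eval_mpoly_reduced)
  qed
  then show "Q = P" by simp
qed

lemma ex_reduced_polynomial:
  assumes "polyfun {..<n} d f"
  obtains P where "reduced n K P" "total_degree P \<le> d"
    "\<And>x. x \<in> points \<Longrightarrow> eval_mpoly P (vec n x) = f x"
proof -
  obtain a where a: "\<And>m. a m \<noteq> 0 \<Longrightarrow> m \<in> exponents \<and> degree_of m \<le> d"
    "\<And>x. x \<in> points \<Longrightarrow> f x = (\<Sum>m\<in>exponents. a m * monom_fun m x)"
    using polyfun_coeffs[OF assms] by blast
  define P where "P = Abs_poly_mapping a"
  have "finite {m. a m \<noteq> 0}" using a(1) by (intro finite_subset[OF _ card_exponents(1)]) auto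
  then have P: "Poly_Mapping.lookup P = a" by (simp add: P_def)
  have red: "reduced n K P" using a(1) by (auto simp: reduced_iff in_keys_iff P)
  show ?thesis
  proof (rule that[OF red])
    show "total_degree P \<le> d" using a(1) by (auto simp: total_degree_le_iff[OF red] in_keys_iff P)
    show "eval_mpoly P (vec n x) = f x" if "x \<in> points" for x
      using a(2)[OF that] by (simp add: eval_mpoly_reduced[OF red] P)
  qed
qed

text \<open>The bridge to \<open>polyfun\<close>. Interpolation provides a reduced polynomial for
  every \<open>F\<close>, so the definite description always denotes; reduction does not raise the
  degree.\<close>

lemma function_degree_le_iff:
  "function_degree n K F \<le> d \<longleftrightarrow> (\<exists>f. polyfun {..<n} d f \<and> (\<forall>x\<in>points. F (vec n x) = f x))"
proof
  assume le: "function_degree n K F \<le> d"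
  obtain e g where g: "polyfun {..<n} e g" "\<And>x. x \<in> points \<Longrightarrow> g x = F (vec n x)"
    by (rule polyfun_interpolation[of "{..<n}" K "\<lambda>x. F (vec n x)"]) auto
  obtain P where P: "reduced n K P" "\<And>x. x \<in> points \<Longrightarrow> eval_mpoly P (vec n x) = g x"
    by (rule ex_reduced_polynomial[OF g(1)]) blast
  have "reduced_polynomial n K F = P" using P g(2) by (intro reduced_polynomial_eqI) auto
  then have deg: "degree_of m \<le> d" if "m \<in> Poly_Mapping.keys P" for m
    using le that total_degree_le_iff[OF P(1)] by (simp add: function_degree_def)
  define f where "f x = (\<Sum>m\<in>Poly_Mapping.keys P. Poly_Mapping.lookup P m * monom_fun m x)" for x
  have pow: "polyfun {..<n} e (\<lambda>x. x i ^ e)" if "i < n" for i e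
    using polyfun_prod[of "{..<e}" "{..<n}" "\<lambda>_. 1" "\<lambda>_ x. x i"] polyfun_var[of i "{..<n}"] that by simp
  have "polyfun {..<n} d f"
    unfolding f_def monom_fun_def
  proof (intro polyfun_sum polyfun_cmult)
    fix m assume m: "m \<in> Poly_Mapping.keys P"
    show "polyfun {..<n} d (\<lambda>x. \<Prod>i<n. x i ^ Poly_Mapping.lookup m i)"
      by (rule polyfun_mono[OF polyfun_prod deg[OF m]]) (use pow in auto)
  qed
  moreover have "F (vec n x) = f x" if x: "x \<in> points" for x
  proof -
    have "F (vec n x) = eval_mpoly P (vec n x)" using P(2)[OF x] g(2)[OF x] by simp
    also have "\<dots> = f x"
      unfolding eval_mpoly_def f_def using P(1) by (intro sum.cong) (auto simp: reduced_iff monom_fun_keys)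
    finally show ?thesis .
  qed
  ultimately show "\<exists>f. polyfun {..<n} d f \<and> (\<forall>x\<in>points. F (vec n x) = f x)" by blast
next
  assume "\<exists>f. polyfun {..<n} d f \<and> (\<forall>x\<in>points. F (vec n x) = f x)"
  then obtain f where f: "polyfun {..<n} d f" "\<And>x. x \<in> points \<Longrightarrow> F (vec n x) = f x" by blast
  obtain P where P: "reduced n K P" "total_degree P \<le> d"
    "\<And>x. x \<in> points \<Longrightarrow> eval_mpoly P (vec n x) = f x"
    by (rule ex_reduced_polynomial[OF f(1)]) blast
  have "reduced_polynomial n K F = P" using P f by (intro reduced_polynomial_eqI) auto
  then show "function_degree n K F \<le> d" using P(2) by (simp add: function_degree_def)
qed

lemma cartesian_code_iff:
  "F \<in> cartesian_code n K d \<longleftrightarrow> F \<in> functions_on (cartesian n K) \<and>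
    (\<exists>f. polyfun {..<n} d f \<and> (\<forall>x\<in>points. F (vec n x) = f x))"
proof -
  have "\<exists>f. polyfun {..<n} d f \<and> (\<forall>x\<in>points. F (vec n x) = f x)"
    if "F = zero_function (cartesian n K)"
    using that by (intro exI[of _ "\<lambda>_. 0"]) (auto simp: cartesian_eq polyfun.const)
  then show ?thesis unfolding cartesian_code_def function_degree_le_iff by blast
qed

lemma weight_eq:
  assumes "\<And>x. x \<in> points \<Longrightarrow> F (vec n x) = f x"
  shows "weight (cartesian n K) F = card (supp {..<n} K f)"
proof -
  have "{\<alpha> \<in> cartesian n K. F \<alpha> \<noteq> 0} = vec n ` supp {..<n} K f"
    using assms by (auto simp: cartesian_eq supp_def)
  moreover have "inj_on (vec n) (supp {..<n} K f)"
    by (rule inj_on_subset[OF inj_on_vec]) (auto simp: supp_def)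
  ultimately show ?thesis by (simp add: weight_def card_image)
qed

text \<open>The product of linear factors given by an optimal vector is a codeword of weight
  \<open>min_prod\<close>. The opposite inequality is supplied by
  \<open>min_prod_le_card_supp\<close>.\<close>

lemma min_distance_le:
  "min_distance n K d \<le> min_prod {..<n} D d"
proof -
  let ?X = "cartesian n K"
  obtain b where b: "optimal {..<n} D d b"
    by (rule ex_optimal[of "{..<n}" D]) (use card_ge_2 in \<open>force simp: Suc_le_eq\<close>)+
  then have bD: "1 \<le> b i" "b i \<le> D i" if "i < n" for i
    using that by (auto simp: optimal_def feasible_def)
  have "\<exists>C\<subseteq>K i. card C = D i - b i" for i by (rule obtain_subset_with_card_n[of "D i - b i" "K i"]) auto
  then obtain C where C: "\<And>i. C i \<subseteq> K i" "\<And>i. card (C i) = D i - b i" by metis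
  define g where "g x = (\<Prod>i<n. \<Prod>c\<in>C i. x i - c)" for x
  have g: "polyfun {..<n} d g"
    unfolding g_def
    by (rule polyfun_mono[OF polyfun_box]) (use b C in \<open>auto simp: optimal_def feasible_def\<close>)
  have "supp {..<n} K g = PiE {..<n} (\<lambda>i. K i - C i)" unfolding g_def by (rule supp_box) simp
  then have "card (supp {..<n} K g) = (\<Prod>i<n. D i - (D i - b i))"
    using C by (simp add: card_PiE card_Diff_subset)
  also have "\<dots> = prod b {..<n}" using bD by (intro prod.cong) auto
  finally have card: "card (supp {..<n} K g) = min_prod {..<n} D d" using b by (simp add: optimal_def)
  define G where "G = (\<lambda>\<alpha>\<in>?X. g (\<lambda>i. \<alpha> $ i))"
  have Gg: "G (vec n x) = g x" if "x \<in> points" for x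
    using that by (auto simp: G_def cartesian_eq g_def intro!: prod.cong)
  have w: "weight ?X G = min_prod {..<n} D d" using weight_eq[of G g] Gg card by simp
  have "0 < min_prod {..<n} D d"
    by (rule min_prod_pos) (use card_ge_2 in \<open>force simp: Suc_le_eq\<close>)
  moreover have "weight ?X (zero_function ?X) = 0" by (simp add: weight_def)
  ultimately have "G \<noteq> zero_function ?X" using w by auto
  moreover have "G \<in> cartesian_code n K d"
    unfolding cartesian_code_iff using g Gg by (auto simp: G_def)
  ultimately have "weight ?X G \<in> weight ?X ` (cartesian_code n K d - {zero_function ?X})" by blast
  moreover have "finite (cartesian_code n K d)"
  proof (rule finite_subset)
    show "cartesian_code n K d \<subseteq> functions_on ?X" by (auto simp: cartesian_code_def)
    show "finite (functions_on ?X :: ('a vec \<Rightarrow> 'a) set)"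
      by (simp add: finite_PiE cartesian_eq)
  qed
  ultimately show ?thesis unfolding min_distance_def w[symmetric] by (intro Min_le) auto
qed

lemma min_weight_of_codeword:
  assumes "F \<in> cartesian_code n K d" "F \<noteq> zero_function (cartesian n K)"
    and "weight (cartesian n K) F = min_distance n K d"
  obtains f where "min_weight {..<n} d f" "\<And>x. x \<in> points \<Longrightarrow> F (vec n x) = f x"
proof -
  obtain f where f: "polyfun {..<n} d f" "\<And>x. x \<in> points \<Longrightarrow> F (vec n x) = f x"
    and F: "F \<in> functions_on (cartesian n K)"
    using assms(1) unfolding cartesian_code_iff by blast
  have "supp {..<n} K f \<noteq> {}"
  proof
    assume "supp {..<n} K f = {}"
    then have "F \<alpha> = 0" if "\<alpha> \<in> cartesian n K" for \<alpha>
      using that f(2) by (auto simp: cartesian_eq supp_def)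
    then have "F = zero_function (cartesian n K)"
      by (intro PiE_ext[OF F]) simp_all
    then show False using assms(2) by simp
  qed
  moreover have "card (supp {..<n} K f) = min_prod {..<n} D d"
    using weight_eq[of F f] f min_prod_le_card_supp[OF _ f(1) \<open>supp {..<n} K f \<noteq> {}\<close>]
      min_distance_le[of d] assms(3) by simp
  ultimately show ?thesis using that f by (auto simp: min_weight_def)
qed

end

section \<open>Affine equivalence\<close>

lemma affine_coordinates:
  fixes \<phi> :: "(nat \<Rightarrow> 'a::comm_ring_1) \<Rightarrow> nat \<Rightarrow> 'a"
  assumes "\<And>x r. r < n \<Longrightarrow> \<phi> x r = (\<Sum>s<n. a r s * x s) + b r"
  shows "\<exists>A\<in>carrier_mat n n. \<exists>\<beta>\<in>carrier_vec n. \<forall>x. vec n (\<phi> x) = A *\<^sub>v vec n x + \<beta>"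
proof (intro bexI allI)
  fix x
  show "vec n (\<phi> x) = mat n n (\<lambda>(r, s). a r s) *\<^sub>v vec n x + vec n b"
    using assms by (intro eq_vecI) (auto simp: scalar_prod_def lessThan_atLeast0)
qed auto

lemma moves_affine:
  fixes K :: "nat \<Rightarrow> 'a::field set"
  assumes "moves {..<n} K \<phi>"
  shows "\<exists>A\<in>carrier_mat n n. \<exists>\<beta>\<in>carrier_vec n. \<forall>x. vec n (\<phi> x) = A *\<^sub>v vec n x + \<beta>"
  using assms
proof (induction rule: moves.induct)
  case ident
  show ?case
    by (rule affine_coordinates[where a = "\<lambda>r s. if s = r then 1 else 0" and b = "\<lambda>_. 0"])
      (simp add: if_distrib[of "\<lambda>c. c * _"] cong: if_cong)
next
  case (comp \<phi> \<psi>)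
  from comp.IH(1) obtain A \<beta> where A: "A \<in> carrier_mat n n" "\<beta> \<in> carrier_vec n"
    and \<phi>: "\<And>x. vec n (\<phi> x) = A *\<^sub>v vec n x + \<beta>" by blast
  from comp.IH(2) obtain B \<gamma> where B: "B \<in> carrier_mat n n" "\<gamma> \<in> carrier_vec n"
    and \<psi>: "\<And>x. vec n (\<psi> x) = B *\<^sub>v vec n x + \<gamma>" by blast
  show ?case
  proof (intro bexI allI)
    fix x
    have "vec n (\<phi> (\<psi> x)) = A *\<^sub>v (B *\<^sub>v vec n x + \<gamma>) + \<beta>" by (simp add: \<phi> \<psi>)
    also have "\<dots> = (A *\<^sub>v (B *\<^sub>v vec n x) + A *\<^sub>v \<gamma>) + \<beta>"
      using A B by (subst mult_add_distrib_mat_vec[of _ n n]) auto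
    also have "\<dots> = A *\<^sub>v (B *\<^sub>v vec n x) + (A *\<^sub>v \<gamma> + \<beta>)"
      using A B by (intro assoc_add_vec[of _ n]) auto
    also have "A *\<^sub>v (B *\<^sub>v vec n x) = (A * B) *\<^sub>v vec n x"
      using A B by (intro assoc_mult_mat_vec[symmetric, of _ n n _ n]) auto
    finally show "vec n (\<phi> (\<psi> x)) = (A * B) *\<^sub>v vec n x + (A *\<^sub>v \<gamma> + \<beta>)" .
  qed (use A B in auto)
next
  case (translation i c)
  show ?case
    by (rule affine_coordinates[where a = "\<lambda>r s. if s = r then 1 else 0"
          and b = "\<lambda>r. if r = i then c else 0"])
      (simp add: if_distrib[of "\<lambda>c. c * _"] cong: if_cong)
next
  case (shear i j a)
  show ?case
  proof (rule affine_coordinates[where b = "\<lambda>_. 0"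
        and a = "\<lambda>r s. (if s = r then 1 else 0) + (if s = j then if r = i then a else 0 else 0)"])
    fix x :: "nat \<Rightarrow> 'a" and r assume "r < n"
    then show "(x(i := x i + a * x j)) r =
        (\<Sum>s<n. ((if s = r then 1 else 0) + (if s = j then if r = i then a else 0 else 0)) * x s) + 0"
      using shear by (simp add: distrib_right sum.distrib if_distrib[of "\<lambda>c. c * _"] cong: if_cong)
  qed
next
  case (swap i j)
  show ?case
  proof (rule affine_coordinates[where b = "\<lambda>_. 0"
        and a = "\<lambda>r s. if s = transpose i j r then 1 else 0"])
    fix x :: "nat \<Rightarrow> 'a" and r assume "r < n"
    then have "transpose i j r < n" using swap by (auto simp: transpose_def)
    moreover have "(x(i := x j, j := x i)) r = x (transpose i j r)" by (auto simp: transpose_def)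
    ultimately show "(x(i := x j, j := x i)) r =
        (\<Sum>s<n. (if s = transpose i j r then 1 else 0) * x s) + 0"
      by (simp add: if_distrib[of "\<lambda>c. c * _"] cong: if_cong)
  qed
qed

lemma mat_eq_one_of_fixed_vectors:
  fixes M :: "'a::comm_ring_1 mat"
  assumes M: "M \<in> carrier_mat n n" and fix_vec: "\<And>v. v \<in> carrier_vec n \<Longrightarrow> M *\<^sub>v v = v"
  shows "M = 1\<^sub>m n"
proof (rule eq_matI)
  fix r s assume rs: "r < dim_row (1\<^sub>m n)" "s < dim_col (1\<^sub>m n)"
  have "(M *\<^sub>v unit_vec n s) $ r = M $$ (r, s)" using M rs by simp
  moreover have "(M *\<^sub>v unit_vec n s) $ r = 1\<^sub>m n $$ (r, s)"
    unfolding fix_vec[OF unit_vec_carrier] using rs by simp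
  ultimately show "M $$ (r, s) = 1\<^sub>m n $$ (r, s)" by simp
qed (use M in auto)

text \<open>At the zero vector the identity shows that the composite has no translation part, so its
  linear part fixes every vector.\<close>

lemma mult_eq_one_of_affine_inverse:
  fixes A B :: "'a::comm_ring_1 mat"
  assumes A: "A \<in> carrier_mat n n" "\<beta> \<in> carrier_vec n" and B: "B \<in> carrier_mat n n" "\<gamma> \<in> carrier_vec n"
    and inv: "\<And>v. v \<in> carrier_vec n \<Longrightarrow> A *\<^sub>v (B *\<^sub>v v + \<gamma>) + \<beta> = v"
  shows "A * B = 1\<^sub>m n"
proof (rule mat_eq_one_of_fixed_vectors)
  show "A * B \<in> carrier_mat n n" using A B by simp
  have expand: "A *\<^sub>v (B *\<^sub>v v + \<gamma>) + \<beta> = (A * B) *\<^sub>v v + (A *\<^sub>v \<gamma> + \<beta>)" if v: "v \<in> carrier_vec n" for v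
  proof -
    have "A *\<^sub>v (B *\<^sub>v v + \<gamma>) + \<beta> = (A *\<^sub>v (B *\<^sub>v v) + A *\<^sub>v \<gamma>) + \<beta>"
      using A B v by (subst mult_add_distrib_mat_vec[of _ n n]) auto
    also have "\<dots> = A *\<^sub>v (B *\<^sub>v v) + (A *\<^sub>v \<gamma> + \<beta>)"
      using A B v by (intro assoc_add_vec[of _ n]) auto
    also have "A *\<^sub>v (B *\<^sub>v v) = (A * B) *\<^sub>v v"
      using A B v by (intro assoc_mult_mat_vec[symmetric, of _ n n _ n]) auto
    finally show ?thesis .
  qed
  have "(A * B) *\<^sub>v 0\<^sub>v n = 0\<^sub>v n" using A B by (intro eq_vecI) (auto simp: scalar_prod_def)
  then have "A *\<^sub>v \<gamma> + \<beta> = 0\<^sub>v n"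
    using expand[of "0\<^sub>v n"] inv[of "0\<^sub>v n"] A B by simp
  then show "(A * B) *\<^sub>v v = v" if "v \<in> carrier_vec n" for v
    using expand[OF that] inv[OF that] A B that by simp
qed

context finite_tower
begin

text \<open>The matrix is invertible because the inverse move is affine too. The two moves are
  inverse to each other on all functions, not just on the grid, so the identities hold for all
  vectors.\<close>

lemma moves_affine_maps_on:
  assumes \<phi>: "moves {..<n} K \<phi>"
  obtains \<Psi> where "\<Psi> \<in> affine_maps_on n (cartesian n K)"
    "\<And>x. x \<in> points \<Longrightarrow> \<Psi> (vec n x) = vec n (\<phi> x)"
proof -
  obtain \<psi> where \<psi>: "moves {..<n} K \<psi>" and inv: "\<And>x. \<phi> (\<psi> x) = x" "\<And>x. \<psi> (\<phi> x) = x"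
    using moves_inverse[OF \<phi>] by blast
  obtain A \<beta> where A: "A \<in> carrier_mat n n" "\<beta> \<in> carrier_vec n"
    and A\<phi>: "\<And>x. vec n (\<phi> x) = A *\<^sub>v vec n x + \<beta>" using moves_affine[OF \<phi>] by blast
  obtain B \<gamma> where B: "B \<in> carrier_mat n n" "\<gamma> \<in> carrier_vec n"
    and B\<psi>: "\<And>x. vec n (\<psi> x) = B *\<^sub>v vec n x + \<gamma>" using moves_affine[OF \<psi>] by blast
  have vec: "v = vec n (\<lambda>i. v $ i)" if "v \<in> carrier_vec n" for v :: "'a vec" using that by auto
  have "A *\<^sub>v (B *\<^sub>v v + \<gamma>) + \<beta> = v" if "v \<in> carrier_vec n" for v
    using A\<phi>[of "\<psi> (\<lambda>i. v $ i)"] B\<psi>[of "\<lambda>i. v $ i"] inv(1) vec[OF that] by simp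
  then have AB: "A * B = 1\<^sub>m n" by (rule mult_eq_one_of_affine_inverse[OF A B])
  have "B *\<^sub>v (A *\<^sub>v v + \<beta>) + \<gamma> = v" if "v \<in> carrier_vec n" for v
    using B\<psi>[of "\<phi> (\<lambda>i. v $ i)"] A\<phi>[of "\<lambda>i. v $ i"] inv(2) vec[OF that] by simp
  then have BA: "B * A = 1\<^sub>m n" by (rule mult_eq_one_of_affine_inverse[OF B A])
  have "invertible_mat A"
    unfolding invertible_mat_def inverts_mat_def square_mat.simps using A B AB BA by auto
  define \<Theta> where "\<Theta> = (\<lambda>\<alpha>\<in>carrier_vec n. A *\<^sub>v \<alpha> + \<beta>)"
  have \<Theta>: "\<Theta> \<in> affine_group n" unfolding affine_group_def \<Theta>_def using A \<open>invertible_mat A\<close> by blast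
  have \<Theta>\<phi>: "\<Theta> (vec n x) = vec n (\<phi> x)" for x by (simp add: \<Theta>_def A\<phi>)
  have "\<phi> ` points = points"
  proof
    show "\<phi> ` points \<subseteq> points" using moves_PiE[OF \<phi>] by blast
    show "points \<subseteq> \<phi> ` points"
    proof
      fix x assume "x \<in> points"
      then have "\<psi> x \<in> points" using moves_PiE[OF \<psi>] by blast
      then show "x \<in> \<phi> ` points" using inv(1) by (metis imageI)
    qed
  qed
  then have "\<Theta> ` cartesian n K = cartesian n K"
    unfolding cartesian_eq image_image \<Theta>\<phi> by (metis image_image)
  then have "restrict \<Theta> (cartesian n K) \<in> affine_maps_on n (cartesian n K)"
    unfolding affine_maps_on_def using \<Theta> by blast
  then show ?thesis by (rule that) (auto simp: \<Theta>\<phi> cartesian_eq)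
qed

end

text \<open>For nonzero \<open>a\<close> the product of \<open>a\<close> and
  \<open>inverse a\<close> is 1, which lies in \<open>F\<close>; at 0 the convention
  \<open>inverse 0 = 0\<close> applies.\<close>

lemma subfield_class_ring_inverse:
  fixes F :: "'a::field set"
  assumes "subfield F class_ring" "a \<in> F"
  shows "inverse a \<in> F"
proof (cases "a = 0")
  case True
  then show ?thesis using assms(2) by simp
next
  case False
  have "1 \<in> F" using subringE(3)[OF subfieldE(1)[OF assms(1)]] by simp
  then show ?thesis
    using ring.subfield_m_inv_simprule[OF class_ring.ring_axioms assms(1), of a "inverse a"]
      assms(2) False by simp
qed

lemma finite_tower_of_subfields:
  fixes K :: "nat \<Rightarrow> 'a::{field, finite} set"
  assumes sub: "\<And>i. i < n \<Longrightarrow> subfield (K i) class_ring"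
    and step: "\<And>i. Suc i < n \<Longrightarrow> K i \<subseteq> K (Suc i)"
  shows "finite_tower K n"
proof
  fix i assume "i \<in> {..<n}"
  then have s: "subfield (K i) class_ring" using sub by simp
  note ring = subringE[OF subfieldE(1)[OF s], unfolded class_ring_simps]
  show "0 \<in> K i" "1 \<in> K i" using ring(2,3) by simp_all
  show "a + b \<in> K i" "a * b \<in> K i" if "a \<in> K i" "b \<in> K i" for a b
    using ring(6,7) that by simp_all
  show "- a \<in> K i" "inverse a \<in> K i" if "a \<in> K i" for a
    using ring(5) that subfield_class_ring_inverse[OF s] by simp_all
next
  fix i j assume "i \<in> {..<n}" "j \<in> {..<n}" "i \<le> j"
  from \<open>i \<le> j\<close> \<open>j \<in> {..<n}\<close> show "K i \<subseteq> K j"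
  proof (induction j rule: dec_induct)
    case (step j)
    then have "K i \<subseteq> K j" "K j \<subseteq> K (Suc j)" using assms(2)[of j] by auto
    then show ?case by blast
  qed simp
qed

theorem theorem3p5:
  fixes K :: "nat \<Rightarrow> 'a::{field, finite} set"
    and n k l d :: nat
    and f :: "'a vec \<Rightarrow> 'a"
  assumes "n \<ge> 1"
    and "\<And>i. i < n \<Longrightarrow> subfield (K i) class_ring"
    and "\<And>i. Suc i < n \<Longrightarrow> K i \<subseteq> K (Suc i)"
    and "k < n"
    and "0 < l"
    and "l \<le> card (K k) - 1"
    and "d = (\<Sum>i<k. card (K i) - 1) + l"
    and "f \<in> cartesian_code n K d"
    and "f \<noteq> zero_function (cartesian n K)"
    and "weight (cartesian n K) f = min_distance n K d"
  shows "\<exists>j \<sigma> a. j \<le> k \<and> card (K k) - l \<le> card (K j) \<and> \<sigma> \<noteq> 0 \<and>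
    inj_on a {1..card (K j) - (card (K k) - l)} \<and>
    a ` {1..card (K j) - (card (K k) - l)} \<subseteq> K j \<and>
    equivalent_on n (cartesian n K) f
      (\<lambda>x\<in>cartesian n K. \<sigma> * (\<Prod>i\<in>{..k} - {j}. 1 - x $ i ^ (card (K i) - 1)) *
        (\<Prod>t = 1..card (K j) - (card (K k) - l). x $ j - a t))"
proof -
  interpret finite_tower K n by (rule finite_tower_of_subfields) (use assms in auto)
  interpret code_parameters K n k l d by unfold_locales (use assms in auto)
  obtain F where F: "min_weight {..<n} d F" "\<And>x. x \<in> points \<Longrightarrow> f (vec n x) = F x"
    by (rule min_weight_of_codeword[OF assms(8-10)]) blast
  obtain \<phi> j \<sigma> a where \<phi>: "moves {..<n} K \<phi>" and j: "j \<le> k" "D k - l \<le> D j" "\<sigma> \<noteq> 0"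
    "inj_on a {1..D j - (D k - l)}" "a ` {1..D j - (D k - l)} \<subseteq> K j"
    and F\<phi>: "\<And>x. x \<in> points \<Longrightarrow> F (\<phi> x) = \<sigma> * (\<Prod>i\<in>{..k} - {j}. 1 - x i ^ (D i - 1)) *
      (\<Prod>t = 1..D j - (D k - l). x j - a t)"
    by (rule min_weight_normal_form[OF F(1)]) blast
  define g where "g = (\<lambda>x\<in>cartesian n K. \<sigma> * (\<Prod>i\<in>{..k} - {j}. 1 - x $ i ^ (D i - 1)) *
    (\<Prod>t = 1..D j - (D k - l). x $ j - a t))"
  \<comment> \<open>The normal form describes \<open>F\<close> after \<open>\<phi>\<close>, while
    equivalence asks for \<open>F\<close> as a normal form after a map; hence the inverse
    move.\<close>
  obtain \<psi> where \<psi>: "moves {..<n} K \<psi>" and inv: "\<And>x. \<phi> (\<psi> x) = x"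
    using moves_inverse[OF \<phi>] by blast
  obtain \<Psi> where \<Psi>: "\<Psi> \<in> affine_maps_on n (cartesian n K)"
    "\<And>x. x \<in> points \<Longrightarrow> \<Psi> (vec n x) = vec n (\<psi> x)"
    by (rule moves_affine_maps_on[OF \<psi>]) blast
  have "f \<alpha> = compose (cartesian n K) g \<Psi> \<alpha>" for \<alpha>
  proof (cases "\<alpha> \<in> cartesian n K")
    case True
    then obtain x where x: "x \<in> points" "\<alpha> = vec n x" by (auto simp: cartesian_eq)
    have \<psi>x: "\<psi> x \<in> points" using moves_PiE[OF \<psi> _ x(1)] by simp
    have "f \<alpha> = F (\<phi> (\<psi> x))" using x F(2) inv by simp
    also have "\<dots> = g (vec n (\<psi> x))"
    proof -
      have "vec n (\<psi> x) $ i = \<psi> x i" if "i \<le> k" for i using that k by simp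
      then show ?thesis
        unfolding F\<phi>[OF \<psi>x] using \<psi>x j(1) by (simp add: g_def cartesian_eq)
    qed
    also have "\<dots> = compose (cartesian n K) g \<Psi> \<alpha>" using True x \<Psi>(2) by (simp add: compose_def)
    finally show ?thesis .
  next
    case False
    \<comment> \<open>Off the grid both sides are \<open>undefined\<close>.\<close>
    have "f \<in> functions_on (cartesian n K)" using assms(8) by (simp add: cartesian_code_iff)
    from PiE_arb[OF this False] show ?thesis using False by (simp add: compose_def)
  qed
  then have "equivalent_on n (cartesian n K) f g"
    unfolding equivalent_on_def using \<Psi>(1) by blast
  then show ?thesis using j unfolding g_def by blast
qed

end
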